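(* For a pair $(a,b)\in\mathbb{Z}^2$ let $H(a,b)=\max\{|a|^{1/3},|b|^{1/4}\}$. Then the limit $$\lim_{X\to\infty}\frac{\#\{(a,b)\in\mathbb{Z}^2\colon H(a,b)<X,\ \mathrm{disc}(x^4+ax+b)\text{ is squarefree}\}}{\#\{(a,b)\in\mathbb{Z}^2\colon H(a,b)<X\}}$$ exists and equals $$\frac13\prod_{p\geq5}\Bigl(1 - \frac{2}{p^2} + \frac{1}{p^3}\Bigr),$$ the product taken over primes $p\ge 5$ (this is approximately $28.03\%$).
   Context: The discriminant of $x^4+ax+b$ is $256b^3-27a^4$. An integer is squarefree if it is nonzero and not divisible by $p^2$ for any prime $p$. *)

theory Defs
  imports
    "HOL-Analysis.Analysis"
    "HOL-Computational_Algebra.Computational_Algebra"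
    "Subresultants.Resultant_Prelim"
begin

text \<open>The usual discriminant \<open>(-1)^(n(n-1)/2) Res(f, f') / lc(f)\<close> of a polynomial of degree
  \<open>n \<ge> 1\<close>. The division is exact, since the leading coefficient divides the first column of
  the Sylvester matrix of \<open>f\<close> and \<open>f'\<close>.\<close>

definition poly_disc :: "int poly \<Rightarrow> int" where
  "poly_disc f = (-1) ^ (degree f * (degree f - 1) div 2)
     * (resultant f (pderiv f) div lead_coeff f)"

definition quartic :: "int \<Rightarrow> int \<Rightarrow> int poly" where
  "quartic a b = [:b, a, 0, 0, 1:]"

definition height :: "int \<Rightarrow> int \<Rightarrow> real" where
  "height a b = max (root 3 \<bar>real_of_int a\<bar>) (root 4 \<bar>real_of_int b\<bar>)"

definition pairs_below :: "real \<Rightarrow> (int \<times> int) set" where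
  "pairs_below X = {(a, b). height a b < X}"

definition sqfree_disc_pairs_below :: "real \<Rightarrow> (int \<times> int) set" where
  "sqfree_disc_pairs_below X =
     {(a, b). height a b < X \<and> squarefree (poly_disc (quartic a b))}"

text \<open>Extended by \<open>1\<close> to all naturals, so that the product over the primes \<open>p \<ge> 5\<close>
  becomes an ordinary infinite product over \<open>nat\<close>.\<close>

definition euler_factor :: "nat \<Rightarrow> real" where
  "euler_factor p =
     (if prime p \<and> p \<ge> 5 then 1 - 2 / real p ^ 2 + 1 / real p ^ 3 else 1)"

lemma poly_quartic: "poly (quartic a b) x = x ^ 4 + a * x + b"
  by (simp add: quartic_def algebra_simps power_numeral_reduce)

lemma det_mat_Suc:
  fixes f :: "nat \<Rightarrow> nat \<Rightarrow> int"
  shows "Determinant.det (Matrix.mat (Suc m) (Suc m) (\<lambda>(i, j). f i j)) =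
    (\<Sum>i<Suc m. if f i 0 = 0 then 0 else f i 0 * ((-1) ^ i *
       Determinant.det (Matrix.mat m m
         (\<lambda>(k, j). f (if k < i then k else Suc k) (Suc j)))))"
proof -
  let ?A = "Matrix.mat (Suc m) (Suc m) (\<lambda>(i, j). f i j)"
  have "Determinant.det ?A = (\<Sum>i<Suc m. ?A $$ (i, 0) * Determinant.cofactor ?A i 0)"
    by (rule laplace_expansion_column) auto
  also have "\<dots> = (\<Sum>i<Suc m. if f i 0 = 0 then 0 else f i 0 * ((-1) ^ i *
       Determinant.det (Matrix.mat m m
         (\<lambda>(k, j). f (if k < i then k else Suc k) (Suc j)))))"
  proof (rule sum.cong[OF refl])
    fix i assume i: "i \<in> {..<Suc m}"
    have "mat_delete ?A i 0 = Matrix.mat m m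
         (\<lambda>(k, j). f (if k < i then k else Suc k) (Suc j))"
      using i by (intro eq_matI) (auto simp: mat_delete_def)
    then show "?A $$ (i, 0) * Determinant.cofactor ?A i 0 =
      (if f i 0 = 0 then 0 else f i 0 * ((-1) ^ i *
       Determinant.det (Matrix.mat m m
         (\<lambda>(k, j). f (if k < i then k else Suc k) (Suc j)))))"
      using i by (simp add: Determinant.cofactor_def)
  qed
  finally show ?thesis .
qed

lemma poly_disc_quartic: "poly_disc (quartic a b) = 256 * b ^ 3 - 27 * a ^ 4"
proof -
  have drop: "(if x = 0 then 0 else x * t) = x * t" for x t :: int by simp
  have pd: "pderiv (quartic a b) = [:a, 0, 0, 4:]"
    by (simp add: quartic_def pderiv_pCons)
  have mat_weak_cong: "n = n' \<Longrightarrow> m = m' \<Longrightarrow> Matrix.mat n m f = Matrix.mat n' m' f"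
    for n n' m m' and f :: "nat \<times> nat \<Rightarrow> int" by simp
  have sum_weak_cong: "A = B \<Longrightarrow> sum f A = sum f B"
    for A B and f :: "nat \<Rightarrow> int" by simp
  define F :: "nat \<Rightarrow> nat \<Rightarrow> int" where "F = (\<lambda>i j. if i < 3
      then if i \<le> j \<and> j - i \<le> 4 then coeff [:b, a, 0, 0, 1:] (4 + i - j) else 0
      else if i - 3 \<le> j \<and> j \<le> i then coeff [:a, 0, 0, 4:] (i - j) else 0)"
  have "degree [:b, a, 0, 0, 1:] = 4" "degree [:a, 0, 0, 4:] = 3" by simp_all
  then have "resultant (quartic a b) (pderiv (quartic a b)) =
      Determinant.det (Matrix.mat 7 7 (\<lambda>(i, j). F i j))"
    unfolding pd by (simp only: resultant_def sylvester_mat_def sylvester_mat_sub_def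
        quartic_def F_def) simp
  also have "(7::nat) = Suc (Suc (Suc (Suc (Suc (Suc (Suc 0))))))" by simp
  also have "Determinant.det (Matrix.mat \<dots> \<dots> (\<lambda>(i, j). F i j)) = 256 * b ^ 3 - 27 * a ^ 4"
  proof -
    have F: "F 0 j = coeff [:b, a, 0, 0, 1:] (4 - j) * of_bool (j \<le> 4)"
      "F (Suc 0) j = coeff [:b, a, 0, 0, 1:] (5 - j) * of_bool (1 \<le> j \<and> j \<le> 5)"
      "F (Suc (Suc 0)) j = coeff [:b, a, 0, 0, 1:] (6 - j) * of_bool (2 \<le> j \<and> j \<le> 6)"
      "F (Suc (Suc (Suc k))) j = coeff [:a, 0, 0, 4:] (3 + k - j) * of_bool (k \<le> j \<and> j \<le> 3 + k)"
      for j k by (auto simp: F_def eval_nat_numeral)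
    show ?thesis
      by (simp add: det_mat_Suc drop F coeff_pCons numeral_eq_Suc
          cong: mat_weak_cong sum_weak_cong)
  qed
  finally show ?thesis
    by (simp add: poly_disc_def quartic_def)
qed

end

theory Submission
  imports Defs "HOL-Number_Theory.Number_Theory" "HOL-Real_Asymp.Real_Asymp"
begin

text \<open>The discriminant is \<open>D = 256 b\<^sup>3 - 27 a\<^sup>4\<close>. For fixed \<open>z\<close>, the pairs with \<open>p\<^sup>2 \<nmid> D\<close> for all primes
  \<open>p \<le> z\<close> have the product of the local densities as density, since the condition is periodic;
  for \<open>p \<ge> 5\<close> the pairs with \<open>p\<^sup>2 | D\<close> are those with \<open>p | a\<close> and \<open>p | b\<close>, together with the curve
  \<open>(4 t\<^sup>3, 3 t\<^sup>4)\<close>, \<open>p \<nmid> t\<close>, on which the quartic has a double root. It remains to show that few pairs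
  have \<open>p\<^sup>2 | D\<close> for some \<open>p > z\<close>. If \<open>p\<close> divides \<open>a\<close>, or \<open>p\<close> is at most \<open>Y = X\<^bsup>7/2\<^esup>\<close>, one counts residue
  classes: given \<open>a\<close> prime to \<open>p\<close> there are at most three classes of \<open>b\<close> modulo \<open>p\<^sup>2\<close>.

  For \<open>p > Y\<close> the resolvent cubic \<open>f = x\<^sup>3 - 4 b x + a\<^sup>2\<close> has a root \<open>r\<close> modulo \<open>p\<^sup>2\<close> which is double
  modulo \<open>p\<close>. Hence the binary cubic form \<open>f(p x + r y, y) / p\<^sup>2\<close> is integral, and in a reduced
  basis of the lattice spanned by \<open>(p, 0)\<close> and \<open>(r, 1)\<close> its four coefficients are small. These
  coefficients together with the second coordinates of the basis determine \<open>p\<close>, \<open>a\<^sup>2\<close> and \<open>b\<close>, so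
  that there are only about \<open>X\<^bsup>10\<^esup> / p\<close> pairs for \<open>p\<close> in a dyadic interval. The forms whose leading
  coefficient vanishes come from cubics with an integer root, which are rare.\<close>

section \<open>Counting in boxes\<close>

lemma card_int_open_interval:
  fixes x y :: real
  assumes "x < y"
  shows "finite {k::int. x < k \<and> k < y}"
    and "real (card {k::int. x < k \<and> k < y}) \<le> y - x + 1"
    and "real (card {k::int. x < k \<and> k < y}) \<ge> y - x - 1"
proof -
  have eq: "{k::int. x < k \<and> k < y} = {\<lfloor>x\<rfloor> + 1..\<lceil>y\<rceil> - 1}"
    by (auto simp: floor_less_iff less_ceiling_iff) linarith+
  show "finite {k::int. x < k \<and> k < y}"
    unfolding eq by simp
  have "real (card {k::int. x < k \<and> k < y}) = of_int (\<lceil>y\<rceil> - 1 - \<lfloor>x\<rfloor>)"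
    unfolding eq using assms by (simp add: of_nat_nat) linarith
  then show "real (card {k::int. x < k \<and> k < y}) \<le> y - x + 1"
    "real (card {k::int. x < k \<and> k < y}) \<ge> y - x - 1"
    by linarith+
qed

lemma card_residue_class:
  fixes R :: real and m r :: int
  assumes "m > 0" "R > 0"
  shows "finite {x::int. \<bar>of_int x\<bar> < R \<and> x mod m = r mod m}"
    and "real (card {x::int. \<bar>of_int x\<bar> < R \<and> x mod m = r mod m}) \<le> 2 * R / m + 1"
    and "real (card {x::int. \<bar>of_int x\<bar> < R \<and> x mod m = r mod m}) \<ge> 2 * R / m - 1"
proof -
  let ?K = "{k::int. (- R - r) / m < k \<and> k < (R - r) / m}"
  have mem: "\<bar>of_int (r + m * k)\<bar> < R \<longleftrightarrow> k \<in> ?K" for k :: int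
    using assms by (auto simp: field_simps abs_less_iff)
  have eq: "{x::int. \<bar>of_int x\<bar> < R \<and> x mod m = r mod m} = (\<lambda>k. r + m * k) ` ?K"
    (is "?A = _")
  proof (intro Set.set_eqI iffI)
    fix x assume x: "x \<in> ?A"
    then obtain k where "x = r + m * k"
      by (metis (mono_tags, lifting) mem_Collect_eq mod_eqE)
    then show "x \<in> (\<lambda>k. r + m * k) ` ?K"
      using x mem by blast
  next
    fix x assume "x \<in> (\<lambda>k. r + m * k) ` ?K"
    then show "x \<in> ?A" using mem by auto
  qed
  have inj: "inj_on (\<lambda>k. r + m * k) ?K"
    using assms by (auto simp: inj_on_def)
  have lt: "(- R - r) / m < (R - r) / m"
    using assms by (simp add: divide_strict_right_mono)
  have len: "(R - r) / m - (- R - r) / m = 2 * R / m"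
    unfolding diff_divide_distrib[symmetric] by simp
  note K = card_int_open_interval[OF lt, unfolded len]
  show "finite ?A" unfolding eq using K(1) by simp
  show "real (card ?A) \<le> 2 * R / m + 1" "real (card ?A) \<ge> 2 * R / m - 1"
    unfolding eq card_image[OF inj] using K by auto
qed

lemma residue_class_density:
  fixes m r :: int
  assumes "m > 0"
  shows "((\<lambda>R. real (card {x::int. \<bar>of_int x\<bar> < R \<and> x mod m = r mod m}) / (2 * R))
    \<longlongrightarrow> 1 / m) at_top"
proof (rule tendsto_sandwich)
  show "\<forall>\<^sub>F R in at_top. (2 * R / m - 1) / (2 * R) \<le>
      real (card {x::int. \<bar>of_int x\<bar> < R \<and> x mod m = r mod m}) / (2 * R)"
    using eventually_gt_at_top[of 0]
    by eventually_elim (intro divide_right_mono card_residue_class assms, auto)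
  show "\<forall>\<^sub>F R in at_top. real (card {x::int. \<bar>of_int x\<bar> < R \<and> x mod m = r mod m}) / (2 * R)
      \<le> (2 * R / m + 1) / (2 * R)"
    using eventually_gt_at_top[of 0]
    by eventually_elim (intro divide_right_mono card_residue_class assms, auto)
  show "((\<lambda>R. (2 * R / m - 1) / (2 * R)) \<longlongrightarrow> 1 / m) at_top"
    "((\<lambda>R. (2 * R / m + 1) / (2 * R)) \<longlongrightarrow> 1 / m) at_top"
    using assms by (real_asymp simp: field_simps)+
qed

text \<open>The solutions in the box split into finitely many disjoint products of a residue class
  for \<open>a\<close> and one for \<open>b\<close>, each of density \<open>1 / Q^2\<close>. The
  sides \<open>A\<close> and \<open>B\<close> are independent, since the box in question has sides
  of order \<open>X^3\<close> and \<open>X^4\<close>.\<close>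

lemma periodic_density:
  fixes P :: "int \<Rightarrow> int \<Rightarrow> bool" and Q :: int
  assumes Q: "Q > 0" and per: "\<And>a b. P a b \<longleftrightarrow> P (a mod Q) (b mod Q)"
    and A: "filterlim A at_top at_top" and B: "filterlim B at_top at_top"
  shows "((\<lambda>X::real. real (card {(a, b). \<bar>of_int a\<bar> < A X \<and> \<bar>of_int b\<bar> < B X \<and> P a b})
      / ((2 * A X) * (2 * B X))) \<longlongrightarrow>
    real (card {(a, b). a \<in> {0..<Q} \<and> b \<in> {0..<Q} \<and> P a b}) / real_of_int Q ^ 2) at_top"
proof -
  define G where "G = {(a, b). a \<in> {0..<Q} \<and> b \<in> {0..<Q} \<and> P a b}"
  define N where "N R r = {x::int. \<bar>of_int x\<bar> < R \<and> x mod Q = r mod Q}" for R :: real and r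
  have finG: "finite G"
    unfolding G_def by (rule finite_subset[of _ "{0..<Q} \<times> {0..<Q}"]) auto
  have lim: "((\<lambda>X. \<Sum>(a, b)\<in>G. (real (card (N (A X) a)) / (2 * A X)) *
       (real (card (N (B X) b)) / (2 * B X))) \<longlongrightarrow> (\<Sum>(a, b)\<in>G. 1 / Q * (1 / Q))) at_top"
    unfolding case_prod_beta N_def
    by (intro tendsto_sum tendsto_mult
        filterlim_compose[OF residue_class_density[OF Q] A]
        filterlim_compose[OF residue_class_density[OF Q] B])
  have ev: "\<forall>\<^sub>F X in at_top. (\<Sum>(a, b)\<in>G. (real (card (N (A X) a)) / (2 * A X)) *
       (real (card (N (B X) b)) / (2 * B X))) =
     real (card {(a, b). \<bar>of_int a\<bar> < A X \<and> \<bar>of_int b\<bar> < B X \<and> P a b})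
      / ((2 * A X) * (2 * B X))"
    using A[THEN filterlim_at_top_dense[THEN iffD1], rule_format, of 0]
      B[THEN filterlim_at_top_dense[THEN iffD1], rule_format, of 0]
  proof eventually_elim
    case (elim X)
    have fin: "finite (N (A X) r)" "finite (N (B X) r)" for r
      using card_residue_class(1)[OF Q elim(1)] card_residue_class(1)[OF Q elim(2)]
      by (auto simp: N_def)
    have "{(a, b). \<bar>of_int a\<bar> < A X \<and> \<bar>of_int b\<bar> < B X \<and> P a b} =
      (\<Union>g\<in>G. N (A X) (fst g) \<times> N (B X) (snd g))"
    proof (intro Set.set_eqI iffI)
      fix z assume "z \<in> {(a, b). \<bar>of_int a\<bar> < A X \<and> \<bar>of_int b\<bar> < B X \<and> P a b}"
      then obtain a b where z: "z = (a, b)" "\<bar>of_int a\<bar> < A X" "\<bar>of_int b\<bar> < B X" "P a b" by auto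
      then have "(a mod Q, b mod Q) \<in> G" using Q per[of a b] by (auto simp: G_def)
      then show "z \<in> (\<Union>g\<in>G. N (A X) (fst g) \<times> N (B X) (snd g))"
        using z by (intro UN_I) (auto simp: N_def)
    next
      fix z assume "z \<in> (\<Union>g\<in>G. N (A X) (fst g) \<times> N (B X) (snd g))"
      then obtain a b c d where z: "z = (a, b)" "(c, d) \<in> G" "a \<in> N (A X) c" "b \<in> N (B X) d"
        by auto
      then have "P (a mod Q) (b mod Q)" using per[of c d] by (auto simp: N_def G_def)
      then show "z \<in> {(a, b). \<bar>of_int a\<bar> < A X \<and> \<bar>of_int b\<bar> < B X \<and> P a b}"
        using z per[of a b] by (auto simp: N_def)
    qed
    moreover have "card (\<Union>g\<in>G. N (A X) (fst g) \<times> N (B X) (snd g)) =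
      (\<Sum>g\<in>G. card (N (A X) (fst g) \<times> N (B X) (snd g)))"
    proof (rule card_UN_disjoint[OF finG])
      show "\<forall>g\<in>G. finite (N (A X) (fst g) \<times> N (B X) (snd g))" using fin by auto
      show "\<forall>g\<in>G. \<forall>h\<in>G. g \<noteq> h \<longrightarrow>
          (N (A X) (fst g) \<times> N (B X) (snd g)) \<inter> (N (A X) (fst h) \<times> N (B X) (snd h)) = {}"
        by (auto simp: G_def N_def)
    qed
    ultimately show ?case
      by (simp add: card_cartesian_product case_prod_beta sum_divide_distrib)
  qed
  have "((\<lambda>X. real (card {(a, b). \<bar>of_int a\<bar> < A X \<and> \<bar>of_int b\<bar> < B X \<and> P a b})
      / ((2 * A X) * (2 * B X))) \<longlongrightarrow> (\<Sum>(a, b)\<in>G. 1 / Q * (1 / Q))) at_top"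
    using Lim_transform_eventually[OF lim ev] .
  then show ?thesis
    by (simp add: G_def case_prod_beta power2_eq_square)
qed

text \<open>Chinese remainder theorem in both coordinates: reduction modulo \<open>m\<close> and
  modulo \<open>n\<close> is a bijection that turns the joint condition into a product.\<close>

lemma card_periodic_mult:
  fixes P R :: "int \<Rightarrow> int \<Rightarrow> bool" and m n :: int
  assumes m: "m > 0" and n: "n > 0" and cop: "coprime m n"
    and P: "\<And>a b. P a b \<longleftrightarrow> P (a mod m) (b mod m)"
    and R: "\<And>a b. R a b \<longleftrightarrow> R (a mod n) (b mod n)"
  shows "card {(a, b). a \<in> {0..<m * n} \<and> b \<in> {0..<m * n} \<and> P a b \<and> R a b} =
    card {(a, b). a \<in> {0..<m} \<and> b \<in> {0..<m} \<and> P a b} *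
    card {(a, b). a \<in> {0..<n} \<and> b \<in> {0..<n} \<and> R a b}"
proof -
  let ?f = "\<lambda>(a, b). ((a mod m, b mod m), (a mod n, b mod n))"
  let ?L = "{(a, b). a \<in> {0..<m * n} \<and> b \<in> {0..<m * n} \<and> P a b \<and> R a b}"
  let ?M = "{(a, b). a \<in> {0..<m} \<and> b \<in> {0..<m} \<and> P a b}"
  let ?N = "{(a, b). a \<in> {0..<n} \<and> b \<in> {0..<n} \<and> R a b}"
  have uniq: "a = c" if "a \<in> {0..<m * n}" "c \<in> {0..<m * n}" "a mod m = c mod m" "a mod n = c mod n"
    for a c :: int
    using coprime_cong_mult[of a c m n] that cop
    by (auto simp: cong_def)
  have ex: "\<exists>x\<in>{0..<m * n}. x mod m = a \<and> x mod n = c" if "a \<in> {0..<m}" "c \<in> {0..<n}" for a c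
  proof -
    obtain x where x: "[x = a] (mod m)" "[x = c] (mod n)"
      using binary_chinese_remainder_int[OF cop] by blast
    then have "(x mod (m * n)) mod m = a" "(x mod (m * n)) mod n = c"
      using that by (auto simp: cong_def mod_mult2_eq mod_mod_cancel)
    then show ?thesis using m n by (intro bexI[of _ "x mod (m * n)"]) auto
  qed
  have "bij_betw ?f ?L (?M \<times> ?N)"
  proof (rule bij_betwI')
    fix x y assume "x \<in> ?L" "y \<in> ?L"
    then show "(?f x = ?f y) = (x = y)"
      using uniq by (cases x; cases y) auto
  next
    fix x assume "x \<in> ?L"
    then show "?f x \<in> ?M \<times> ?N"
      using m n P R by (cases x) auto
  next
    fix y assume "y \<in> ?M \<times> ?N"
    then obtain a b c d where y: "y = ((a, b), (c, d))" "(a, b) \<in> ?M" "(c, d) \<in> ?N"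
      by auto
    then obtain u v where "u \<in> {0..<m * n}" "u mod m = a" "u mod n = c"
      "v \<in> {0..<m * n}" "v mod m = b" "v mod n = d"
      using ex[of a c] ex[of b d] by auto
    then show "\<exists>x\<in>?L. y = ?f x"
      using y P[of u v] R[of u v] by (intro bexI[of _ "(u, v)"]) auto
  qed
  then show ?thesis
    using bij_betw_same_card[of ?f ?L "?M \<times> ?N"] card_cartesian_product[of ?M ?N] by simp
qed

section \<open>Local densities\<close>

definition qdisc :: "int \<Rightarrow> int \<Rightarrow> int" where
  "qdisc a b = 256 * b ^ 3 - 27 * a ^ 4"

lemma dvd_qdisc_mod: "m dvd qdisc a b \<longleftrightarrow> m dvd qdisc (a mod m) (b mod m)"
proof -
  have "[qdisc a b = qdisc (a mod m) (b mod m)] (mod m)"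
    unfolding qdisc_def
    by (intro cong_diff cong_mult cong_pow cong_refl) (simp_all add: cong_def)
  then show ?thesis by (rule cong_dvd_iff)
qed

lemma prime_ge_5_not_dvd:
  fixes p :: int
  assumes "prime p" "p \<ge> 5"
  shows "\<not> p dvd 2" "\<not> p dvd 3" "\<not> p dvd 4" "\<not> p dvd 12" "\<not> p dvd 27" "\<not> p dvd 256"
proof -
  show 2: "\<not> p dvd 2" and 3: "\<not> p dvd 3" using assms zdvd_imp_le[of p 2] zdvd_imp_le[of p 3] by auto
  have "\<not> p dvd 2 ^ 2" "\<not> p dvd 3 ^ 3" "\<not> p dvd 2 ^ 8" "\<not> p dvd 2 ^ 2 * 3"
    using 2 3 assms(1) by (metis prime_dvd_power prime_dvd_mult_iff)+
  then show "\<not> p dvd 4" "\<not> p dvd 12" "\<not> p dvd 27" "\<not> p dvd 256" by simp_all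
qed

text \<open>Already modulo \<open>p\<close> one has 256 b^3 = 27 a^4, and 256 and 27 are units
  there.\<close>

lemma prime_sq_dvd_qdisc_imp:
  fixes p :: int
  assumes "prime p" "p \<ge> 5" "p\<^sup>2 dvd qdisc a b"
  shows "p dvd a \<longleftrightarrow> p dvd b"
proof -
  have "p dvd qdisc a b" using assms(3) by (meson dvd_trans dvd_power zero_less_numeral)
  then have "p dvd 256 * b ^ 3 \<longleftrightarrow> p dvd 27 * a ^ 4"
    using dvd_add_left_iff[of p "qdisc a b" "27 * a ^ 4"]
    by (auto simp: qdisc_def dvd_diff_left_iff dest: dvd_add)
  then show ?thesis
    using prime_ge_5_not_dvd[OF assms(1,2)] assms(1)
    by (auto simp: prime_dvd_mult_iff prime_dvd_power_iff)
qed

lemma card_multiples_below_sq: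
  fixes p :: int
  assumes "p > 0"
  shows "card {t \<in> {0..<p\<^sup>2}. p dvd t} = nat p"
proof -
  have "{t \<in> {0..<p\<^sup>2}. p dvd t} = (\<lambda>k. p * k) ` {0..<p}"
  proof (intro Set.set_eqI iffI)
    fix t assume "t \<in> {t \<in> {0..<p\<^sup>2}. p dvd t}"
    then obtain k where "t = p * k" "0 \<le> p * k" "p * k < p * p"
      by (auto simp: power2_eq_square)
    then show "t \<in> (\<lambda>k. p * k) ` {0..<p}"
      using assms by (auto simp: zero_le_mult_iff)
  qed (use assms in \<open>auto simp: power2_eq_square\<close>)
  moreover have "inj_on (\<lambda>k. p * k) {0..<p}" using assms by (auto simp: inj_on_def)
  ultimately show ?thesis by (simp add: card_image)
qed

text \<open>Pairs with both coordinates divisible by \<open>p\<close> number p^2. If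
  \<open>p\<close> divides neither coordinate, the pair lies on the curve (4 t^3, 3 t^4), where the
  discriminant vanishes identically, and the p^2 - p units t parametrize these pairs
  injectively.\<close>

lemma card_bad_mod_prime_sq:
  fixes p :: int
  assumes p: "prime p" and p5: "p \<ge> 5"
  shows "card {(a, b). a \<in> {0..<p\<^sup>2} \<and> b \<in> {0..<p\<^sup>2} \<and> p\<^sup>2 dvd qdisc a b} = nat (2 * p\<^sup>2 - p)"
proof -
  let ?Z = "{t \<in> {0..<p\<^sup>2}. p dvd t}" and ?U = "{t \<in> {0..<p\<^sup>2}. \<not> p dvd t}"
  let ?B = "{(a, b). a \<in> {0..<p\<^sup>2} \<and> b \<in> {0..<p\<^sup>2} \<and> p\<^sup>2 dvd qdisc a b}"
  let ?f = "\<lambda>t. ((4 * t ^ 3) mod p\<^sup>2, (3 * t ^ 4) mod p\<^sup>2)"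
  note nd = prime_ge_5_not_dvd[OF p p5]
  have pp: "p > 0" "p\<^sup>2 > 0" using p5 by auto
  have pdvd: "p dvd x mod p\<^sup>2 \<longleftrightarrow> p dvd x" for x
    by (simp add: dvd_mod_iff power2_eq_square)
  have cop: "coprime x (p\<^sup>2)" if "\<not> p dvd x" for x
    using that p by (simp add: coprime_commute prime_imp_coprime)
  have B: "?B = ?Z \<times> ?Z \<union> ?f ` ?U"
  proof (intro Set.set_eqI iffI)
    fix z assume z: "z \<in> ?B"
    then obtain a b where ab: "z = (a, b)" "a \<in> {0..<p\<^sup>2}" "b \<in> {0..<p\<^sup>2}" "p\<^sup>2 dvd qdisc a b"
      by auto
    show "z \<in> ?Z \<times> ?Z \<union> ?f ` ?U"
    proof (cases "p dvd a")
      case True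
      then show ?thesis using ab prime_sq_dvd_qdisc_imp[OF p p5 ab(4)] by auto
    next
      case False
      have n3a: "\<not> p dvd 3 * a" using False nd p by (simp add: prime_dvd_mult_iff)
      obtain c where c: "[3 * a * c = 1] (mod p\<^sup>2)"
        using cong_solve_coprime_int[OF cop[OF n3a]] by auto
      \<comment> \<open>A point of the curve satisfies 4 b = 3 a t, so the parameter has to be 4 b /
        (3 a); \<open>c\<close> is the inverse of \<open>3 * a\<close>.\<close>
      define t where "t = (4 * b * c) mod p\<^sup>2"
      have "[3 * a * t = 3 * a * (4 * b * c)] (mod p\<^sup>2)"
        by (intro cong_mult cong_refl) (simp add: t_def)
      also have "3 * a * (4 * b * c) = 4 * b * (3 * a * c)" by simp
      also have "[4 * b * (3 * a * c) = 4 * b * 1] (mod p\<^sup>2)"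
        by (intro cong_mult cong_refl c)
      finally have t: "[3 * a * t = 4 * b] (mod p\<^sup>2)" by simp
      have D: "[256 * b ^ 3 = 27 * a ^ 4] (mod p\<^sup>2)"
        using ab(4) by (simp add: qdisc_def cong_iff_dvd_diff)
      \<comment> \<open>Cubing 3 a t = 4 b and inserting \<open>D\<close> recovers \<open>a\<close>;
        the fourth power recovers \<open>b\<close> further down.\<close>
      have "27 * a ^ 3 * (4 * t ^ 3) = 4 * (3 * a * t) ^ 3"
        by (simp add: power_mult_distrib)
      also have "[4 * (3 * a * t) ^ 3 = 4 * (4 * b) ^ 3] (mod p\<^sup>2)"
        by (intro cong_mult cong_refl cong_pow t)
      also have "4 * (4 * b) ^ 3 = 256 * b ^ 3" by (simp add: power_mult_distrib)
      also note D
      also have "27 * a ^ 4 = 27 * a ^ 3 * a" by (simp add: power_numeral_reduce)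
      finally have 1: "[4 * t ^ 3 = a] (mod p\<^sup>2)"
        using cong_mult_lcancel[OF cop, of "27 * a ^ 3" "4 * t ^ 3" a] nd p False
        by (auto simp: prime_dvd_mult_iff prime_dvd_power_iff)
      have "81 * a ^ 4 * (3 * t ^ 4) = 3 * (3 * a * t) ^ 4"
        by (simp add: power_mult_distrib)
      also have "[3 * (3 * a * t) ^ 4 = 3 * (4 * b) ^ 4] (mod p\<^sup>2)"
        by (intro cong_mult cong_refl cong_pow t)
      also have "3 * (4 * b) ^ 4 = 3 * b * (256 * b ^ 3)"
        by (simp add: power_mult_distrib power_numeral_reduce)
      also have "[3 * b * (256 * b ^ 3) = 3 * b * (27 * a ^ 4)] (mod p\<^sup>2)"
        by (intro cong_mult cong_refl D)
      also have "3 * b * (27 * a ^ 4) = 81 * a ^ 4 * b" by simp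
      finally have "[3 ^ 4 * a ^ 4 * (3 * t ^ 4) = 3 ^ 4 * a ^ 4 * b] (mod p\<^sup>2)" by simp
      then have 2: "[3 * t ^ 4 = b] (mod p\<^sup>2)"
        using cong_mult_lcancel[OF cop, of "3 ^ 4 * a ^ 4" "3 * t ^ 4" b] nd p False
        by (simp add: prime_dvd_mult_iff prime_dvd_power_iff del: power_numeral
             power_mult_numeral)
      have "\<not> p dvd t"
      proof
        assume "p dvd t"
        then have "p dvd (4 * t ^ 3) mod p\<^sup>2"
          unfolding pdvd by (simp add: dvd_mult dvd_power_same power3_eq_cube)
        then show False using 1 False ab(2) pdvd by (metis cong_def)
      qed
      moreover have "t \<in> {0..<p\<^sup>2}" using pp by (auto simp: t_def)
      moreover have "z = ?f t" using 1 2 ab by (simp add: cong_def)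
      ultimately show ?thesis by blast
    qed
  next
    fix z assume "z \<in> ?Z \<times> ?Z \<union> ?f ` ?U"
    then consider (Z) a b where "z = (a, b)" "a \<in> ?Z" "b \<in> ?Z" | (U) t where "t \<in> ?U" "z = ?f t"
      by auto
    then show "z \<in> ?B"
    proof cases
      case Z
      then have "p\<^sup>2 dvd a ^ 2" "p\<^sup>2 dvd b ^ 2" by (auto intro: dvd_power_same)
      then have "p\<^sup>2 dvd 256 * b * b ^ 2 - 27 * a ^ 2 * a ^ 2"
        by (intro dvd_diff dvd_mult)
      also have "\<dots> = qdisc a b" by (simp add: qdisc_def power_numeral_reduce)
      finally show ?thesis using Z by auto
    next
      case U
      have "qdisc (4 * t ^ 3) (3 * t ^ 4) = 0"
        by (simp add: qdisc_def power_mult_distrib power_mult[symmetric])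
      then have "p\<^sup>2 dvd qdisc ((4 * t ^ 3) mod p\<^sup>2) ((3 * t ^ 4) mod p\<^sup>2)"
        using dvd_qdisc_mod[of "p\<^sup>2" "4 * t ^ 3" "3 * t ^ 4"] by simp
      then show ?thesis using U pp by auto
    qed
  qed
  have inj: "inj_on ?f ?U"
  proof (rule inj_onI)
    fix s t assume s: "s \<in> ?U" and t: "t \<in> ?U" and eq: "?f s = ?f t"
    have 1: "[4 * s ^ 3 = 4 * t ^ 3] (mod p\<^sup>2)" and 2: "[3 * s ^ 4 = 3 * t ^ 4] (mod p\<^sup>2)"
      using eq by (auto simp: cong_def)
    \<comment> \<open>The relation 3 a t = 4 b again determines the parameter from the
      point.\<close>
    have "12 * s ^ 3 * s = 4 * (3 * s ^ 4)" by (simp add: power_numeral_reduce)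
    also have "[4 * (3 * s ^ 4) = 4 * (3 * t ^ 4)] (mod p\<^sup>2)" by (intro cong_mult cong_refl 2)
    also have "4 * (3 * t ^ 4) = (4 * t ^ 3) * (3 * t)" by (simp add: power_numeral_reduce)
    also have "[(4 * t ^ 3) * (3 * t) = (4 * s ^ 3) * (3 * t)] (mod p\<^sup>2)"
      by (intro cong_mult cong_refl cong_sym[OF 1])
    also have "(4 * s ^ 3) * (3 * t) = 12 * s ^ 3 * t" by simp
    finally have "[s = t] (mod p\<^sup>2)"
      using cong_mult_lcancel[OF cop, of "12 * s ^ 3" s t] nd p s
      by (auto simp: prime_dvd_mult_iff prime_dvd_power_iff)
    then show "s = t" using s t by (simp add: cong_def)
  qed
  have disj: "(?Z \<times> ?Z) \<inter> ?f ` ?U = {}"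
    using nd p by (auto simp: pdvd prime_dvd_mult_iff prime_dvd_power_iff)
  have cZ: "card ?Z = nat p" by (rule card_multiples_below_sq[OF pp(1)])
  have fin: "finite ?Z" "finite ?U" by (rule finite_subset[of _ "{0..<p\<^sup>2}"]; auto)+
  have "?Z \<union> ?U = {0..<p\<^sup>2}" "?Z \<inter> ?U = {}" by auto
  then have "card ?Z + card ?U = nat (p\<^sup>2)"
    using card_Un_disjoint[OF fin] by simp
  moreover have "card ?B = card ?Z * card ?Z + card ?U"
    unfolding B using disj fin card_Un_disjoint[of "?Z \<times> ?Z" "?f ` ?U"]
    by (simp only: card_cartesian_product card_image[OF inj] finite_cartesian_product finite_imageI)
  ultimately have "int (card ?B) = 2 * p\<^sup>2 - p"
    using cZ pp by (simp add: power2_eq_square)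
  then show ?thesis by linarith
qed

lemma card_good_mod_prime_sq:
  fixes p :: nat
  assumes p: "prime p" and p5: "p \<ge> 5"
  shows "real (card {(a, b). a \<in> {0..<(int p)\<^sup>2} \<and> b \<in> {0..<(int p)\<^sup>2} \<and> \<not> (int p)\<^sup>2 dvd qdisc a b})
    = (1 - 2 / real p ^ 2 + 1 / real p ^ 3) * (real p ^ 2) ^ 2"
proof -
  let ?I = "{0..<(int p)\<^sup>2}"
  let ?B = "{(a, b). a \<in> ?I \<and> b \<in> ?I \<and> (int p)\<^sup>2 dvd qdisc a b}"
  let ?G = "{(a, b). a \<in> ?I \<and> b \<in> ?I \<and> \<not> (int p)\<^sup>2 dvd qdisc a b}"
  have U: "?B \<union> ?G = ?I \<times> ?I" "?B \<inter> ?G = {}" by auto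
  have fin: "finite ?B" "finite ?G" by (rule finite_subset[of _ "?I \<times> ?I"]; auto)+
  have "card ?B + card ?G = card (?I \<times> ?I)"
    unfolding U(1)[symmetric] by (rule card_Un_disjoint[OF fin U(2), symmetric])
  moreover have "card (?I \<times> ?I) = (p\<^sup>2)\<^sup>2"
    by (simp add: card_cartesian_product nat_power_eq flip: power2_eq_square)
  moreover have "int (card ?B) = 2 * (int p)\<^sup>2 - int p"
  proof -
    \<comment> \<open>Nonnegativity makes the \<open>nat\<close> in the count of bad pairs
      exact.\<close>
    have "int p * 1 \<le> int p * int p" using p5 by (intro mult_left_mono) auto
    then have "0 \<le> 2 * (int p)\<^sup>2 - int p" unfolding power2_eq_square by linarith
    moreover have "prime (int p)" "int p \<ge> 5" using p p5 by auto
    ultimately show ?thesis using card_bad_mod_prime_sq[of "int p"] by (simp only: int_nat_eq if_True)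
  qed
  ultimately have "int (card ?G) = (int p ^ 2) ^ 2 - (2 * (int p)\<^sup>2 - int p)"
    by (simp flip: of_nat_power)
  then have "real_of_int (int (card ?G)) = real_of_int ((int p ^ 2) ^ 2 - (2 * (int p)\<^sup>2 - int p))"
    by (rule arg_cong)
  then have *: "real (card ?G) = (real p ^ 2) ^ 2 - (2 * (real p)\<^sup>2 - real p)"
    by simp
  show ?thesis
    unfolding * using p5 by (simp add: field_simps power_numeral_reduce)
qed

text \<open>Modulo 4 the discriminant is congruent to a^4, so exactly the pairs with odd
  \<open>a\<close> survive.\<close>

lemma card_good_mod_4:
  "card {(a, b). a \<in> {0..<4} \<and> b \<in> {0..<4} \<and> \<not> 4 dvd qdisc a b} = 8"
proof -
  have I: "{0..<4} = {0, 1, 2, 3 :: int}" by auto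
  have "{(a, b). a \<in> {0..<4} \<and> b \<in> {0..<4} \<and> \<not> 4 dvd qdisc a b} = {1, 3} \<times> {0..<4}"
    unfolding I by (auto simp: qdisc_def)
  then show ?thesis by simp
qed

text \<open>Modulo 9 the term with 27 drops out, and what remains is the condition that 3 does not
  divide \<open>b\<close>.\<close>

lemma card_good_mod_9:
  "card {(a, b). a \<in> {0..<9} \<and> b \<in> {0..<9} \<and> \<not> 9 dvd qdisc a b} = 54"
proof -
  have I: "{0..<9} = {0, 1, 2, 3, 4, 5, 6, 7, 8 :: int}" by auto
  have "9 dvd 27 * a ^ 4" for a :: int
    by (rule dvd_mult2) simp
  then have 9: "9 dvd qdisc a b \<longleftrightarrow> 9 dvd 256 * b ^ 3" for a b
    unfolding qdisc_def by (rule dvd_diff_left_iff)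
  have "{b \<in> {0..<9}. \<not> 9 dvd 256 * b ^ 3} = {1, 2, 4, 5, 7, 8 :: int}"
    unfolding I by auto
  then have "{(a, b). a \<in> {0..<9} \<and> b \<in> {0..<9} \<and> \<not> 9 dvd qdisc a b} = {0..<9} \<times> {1, 2, 4, 5, 7, 8}"
    unfolding 9 by blast
  then show ?thesis by (simp add: card_cartesian_product)
qed

text \<open>The values at 2 and 3 are 8/16 and 54/81. Their product is the 1/3 in front of the Euler
  product, whereas \<open>euler_factor\<close> is 1 at both primes.\<close>

definition euler_density :: "nat \<Rightarrow> real" where
  "euler_density p = (if p = 2 then 1 / 2 else if p = 3 then 2 / 3
     else 1 - 2 / real p ^ 2 + 1 / real p ^ 3)"

lemma local_density:
  assumes "prime p"
  shows "real (card {(a, b). a \<in> {0..<(int p)\<^sup>2} \<and> b \<in> {0..<(int p)\<^sup>2} \<and> \<not> (int p)\<^sup>2 dvd qdisc a b})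
    = euler_density p * (real p ^ 2) ^ 2"
proof -
  consider "p = 2" | "p = 3" | "p \<ge> 5"
  proof -
    have "\<not> prime (4::nat)" by simp
    then have "p \<noteq> 4" using assms by metis
    then show thesis using prime_ge_2_nat[OF assms] that by linarith
  qed
  then show ?thesis
  proof cases
    case 1
    then show ?thesis using card_good_mod_4 by (simp add: euler_density_def)
  next
    case 2
    then show ?thesis using card_good_mod_9 by (simp add: euler_density_def)
  next
    case 3
    then show ?thesis using card_good_mod_prime_sq[OF assms 3] by (simp add: euler_density_def)
  qed
qed

section \<open>Densities for finitely many primes\<close>

lemma card_good_mod_primes:
  assumes "finite S" "\<And>p. p \<in> S \<Longrightarrow> prime p"
  shows "real (card {(a, b). a \<in> {0..<\<Prod>p\<in>S. (int p)\<^sup>2} \<and> b \<in> {0..<\<Prod>p\<in>S. (int p)\<^sup>2} \<and>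
      (\<forall>p\<in>S. \<not> (int p)\<^sup>2 dvd qdisc a b)})
    = (\<Prod>p\<in>S. euler_density p) * (\<Prod>p\<in>S. real p ^ 2) ^ 2"
  using assms
proof (induction S rule: finite_induct)
  case empty
  have "{(a, b). a \<in> {0..<1::int} \<and> b \<in> {0..<1::int}} = {(0, 0)}" by auto
  then show ?case by simp
next
  case (insert q S)
  define Q where "Q = (\<Prod>p\<in>S. (int p)\<^sup>2)"
  have pos: "Q > 0" "(int q)\<^sup>2 > 0"
    unfolding Q_def using insert.prems prime_gt_0_nat by (auto intro!: prod_pos)
  have cop: "coprime ((int q)\<^sup>2) Q"
    unfolding Q_def
  proof (rule prod_coprime_right)
    fix p assume "p \<in> S"
    then have "coprime q p" using insert by (intro primes_coprime) auto
    then show "coprime ((int q)\<^sup>2) ((int p)\<^sup>2)" by simp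
  qed
  have per: "(\<forall>p\<in>S. \<not> (int p)\<^sup>2 dvd qdisc a b) \<longleftrightarrow>
      (\<forall>p\<in>S. \<not> (int p)\<^sup>2 dvd qdisc (a mod Q) (b mod Q))" for a b
  proof (rule ball_cong[OF refl])
    fix p assume "p \<in> S"
    then have "(int p)\<^sup>2 dvd Q" unfolding Q_def using insert(1) by (intro dvd_prodI) auto
    then show "(\<not> (int p)\<^sup>2 dvd qdisc a b) = (\<not> (int p)\<^sup>2 dvd qdisc (a mod Q) (b mod Q))"
      using dvd_qdisc_mod[of "(int p)\<^sup>2" a b] dvd_qdisc_mod[of "(int p)\<^sup>2" "a mod Q" "b mod Q"]
      by (simp add: mod_mod_cancel)
  qed
  have per': "(\<not> (int q)\<^sup>2 dvd qdisc a b) \<longleftrightarrow>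
      (\<not> (int q)\<^sup>2 dvd qdisc (a mod (int q)\<^sup>2) (b mod (int q)\<^sup>2))" for a b
    using dvd_qdisc_mod by metis
  have IH: "real (card {(a, b). a \<in> {0..<Q} \<and> b \<in> {0..<Q} \<and> (\<forall>p\<in>S. \<not> (int p)\<^sup>2 dvd qdisc a b)})
    = (\<Prod>p\<in>S. euler_density p) * (\<Prod>p\<in>S. real p ^ 2) ^ 2"
    unfolding Q_def using insert by simp
  have q: "prime q" using insert.prems by simp
  show ?case
    using card_periodic_mult[of _ _ "\<lambda>a b. \<not> (int q)\<^sup>2 dvd qdisc a b"
        "\<lambda>a b. \<forall>p\<in>S. \<not> (int p)\<^sup>2 dvd qdisc a b", OF pos(2) pos(1) cop per' per] IH local_density[OF q] insert(1,2)
    by (simp add: Q_def[symmetric] power_mult_distrib)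
qed

lemma sieved_density:
  assumes S: "finite S" "\<And>p. p \<in> S \<Longrightarrow> prime p"
    and A: "filterlim A at_top at_top" and B: "filterlim B at_top at_top"
  shows "((\<lambda>X::real. real (card {(a, b). \<bar>of_int a\<bar> < A X \<and> \<bar>of_int b\<bar> < B X \<and>
      (\<forall>p\<in>S. \<not> (int p)\<^sup>2 dvd qdisc a b)})
      / ((2 * A X) * (2 * B X))) \<longlongrightarrow> (\<Prod>p\<in>S. euler_density p)) at_top"
proof -
  define Q where "Q = (\<Prod>p\<in>S. (int p)\<^sup>2)"
  have pos: "Q > 0"
    unfolding Q_def using S prime_gt_0_nat by (auto intro!: prod_pos)
  have per: "(\<forall>p\<in>S. \<not> (int p)\<^sup>2 dvd qdisc a b) \<longleftrightarrow>
      (\<forall>p\<in>S. \<not> (int p)\<^sup>2 dvd qdisc (a mod Q) (b mod Q))" for a b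
  proof (rule ball_cong[OF refl])
    fix p assume "p \<in> S"
    then have "(int p)\<^sup>2 dvd Q" unfolding Q_def using S(1) by (intro dvd_prodI) auto
    then show "(\<not> (int p)\<^sup>2 dvd qdisc a b) = (\<not> (int p)\<^sup>2 dvd qdisc (a mod Q) (b mod Q))"
      using dvd_qdisc_mod[of "(int p)\<^sup>2" a b] dvd_qdisc_mod[of "(int p)\<^sup>2" "a mod Q" "b mod Q"]
      by (simp add: mod_mod_cancel)
  qed
  have Qr: "real_of_int Q = (\<Prod>p\<in>S. real p ^ 2)" by (simp add: Q_def)
  show ?thesis
    using periodic_density[of Q "\<lambda>a b. \<forall>p\<in>S. \<not> (int p)\<^sup>2 dvd qdisc a b", OF pos per A B] card_good_mod_primes[OF S, folded Q_def] pos Qr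
    by simp
qed

section \<open>Residue classes for primes of moderate size\<close>

lemma real_card_UN_le:
  assumes "finite I"
  shows "real (card (\<Union>i\<in>I. F i)) \<le> (\<Sum>i\<in>I. real (card (F i)))"
proof -
  have "real (card (\<Union>i\<in>I. F i)) \<le> real (\<Sum>i\<in>I. card (F i))"
    using card_UN_le[OF assms, of F] by (simp only: of_nat_le_iff)
  then show ?thesis by simp
qed

text \<open>All solutions are prime to \<open>p\<close> and have the same cube modulo p^2. Cube
  roots that are units lift uniquely from \<open>p\<close> to p^2, and modulo \<open>p\<close> there
  are at most three.\<close>

lemma card_residues_qdisc:
  fixes p :: nat
  assumes p: "prime p" and p5: "p \<ge> 5" and a: "\<not> int p dvd a"
  shows "card {r \<in> {0..<(int p)\<^sup>2}. (int p)\<^sup>2 dvd qdisc a r} \<le> 3"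
proof (cases "{r \<in> {0..<(int p)\<^sup>2}. (int p)\<^sup>2 dvd qdisc a r} = {}")
  case True
  show ?thesis unfolding True by simp
next
  case False
  let ?R = "{r \<in> {0..<(int p)\<^sup>2}. (int p)\<^sup>2 dvd qdisc a r}"
  have ip: "prime (int p)" "int p \<ge> 5" using p p5 by auto
  note nd = prime_ge_5_not_dvd[OF ip]
  have pos: "int p > 0" using p5 by simp
  have cop: "coprime ((int p)\<^sup>2) x" if "\<not> int p dvd x" for x
    using that ip by (simp add: prime_imp_coprime)
  have cube: "(int p)\<^sup>2 dvd r ^ 3 - s ^ 3" if "r \<in> ?R" "s \<in> ?R" for r s
  proof -
    have "(int p)\<^sup>2 dvd qdisc a r - qdisc a s" using that by (intro dvd_diff) auto
    also have "qdisc a r - qdisc a s = 256 * (r ^ 3 - s ^ 3)"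
      by (simp add: qdisc_def algebra_simps)
    finally show ?thesis
      using coprime_dvd_mult_right_iff[OF cop[OF nd(6)]] by blast
  qed
  have pr: "\<not> int p dvd r" if "r \<in> ?R" for r
    using prime_sq_dvd_qdisc_imp[OF ip] a that by blast
  obtain r0 where r0: "r0 \<in> ?R" using False by blast
  define c where "c = nat (r0 ^ 3 mod int p)"
  let ?f = "\<lambda>r. nat (r mod int p)"
  have "inj_on ?f ?R"
  proof (rule inj_onI)
    fix r s assume r: "r \<in> ?R" and s: "s \<in> ?R" and "?f r = ?f s"
    then have "r mod int p = s mod int p"
      using pos by (simp add: nat_eq_iff)
    then have rs: "int p dvd r - s" by (simp add: mod_eq_dvd_iff)
    \<comment> \<open>The cofactor of r - s in r^3 - s^3 is congruent to 3 r^2 modulo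
      \<open>p\<close>, a unit, so the whole p^2 divides r - s.\<close>
    have "\<not> int p dvd r\<^sup>2 + r * s + s\<^sup>2"
    proof
      assume "int p dvd r\<^sup>2 + r * s + s\<^sup>2"
      moreover have "int p dvd (r - s) * (2 * r + s)" using rs by simp
      ultimately have "int p dvd (r\<^sup>2 + r * s + s\<^sup>2) + (r - s) * (2 * r + s)" by (rule dvd_add)
      also have "(r\<^sup>2 + r * s + s\<^sup>2) + (r - s) * (2 * r + s) = 3 * r\<^sup>2"
        by (simp add: algebra_simps power2_eq_square)
      finally show False using pr[OF r] nd ip by (auto simp: prime_dvd_mult_iff prime_dvd_power_iff)
    qed
    moreover have "r ^ 3 - s ^ 3 = (r\<^sup>2 + r * s + s\<^sup>2) * (r - s)"
      by (simp add: algebra_simps power2_eq_square power3_eq_cube)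
    ultimately have "(int p)\<^sup>2 dvd r - s"
      using cube[OF r s] coprime_dvd_mult_right_iff[OF cop] by metis
    then have "r mod (int p)\<^sup>2 = s mod (int p)\<^sup>2" by (simp add: mod_eq_dvd_iff)
    then show "r = s" using r s by simp
  qed
  then have "card ?R = card (?f ` ?R)" by (simp add: card_image)
  also have "\<dots> \<le> card {x \<in> {..<p}. [x ^ 3 = c] (mod p)}"
  proof (rule card_mono)
    show "?f ` ?R \<subseteq> {x \<in> {..<p}. [x ^ 3 = c] (mod p)}"
    proof safe
      fix r assume "r \<in> {0..<(int p)\<^sup>2}" and "(int p)\<^sup>2 dvd qdisc a r"
      then have r: "r \<in> ?R" by blast
      show "?f r < p" using pos by (simp add: nat_less_iff)
      have "int p dvd r ^ 3 - r0 ^ 3"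
        using cube[OF r r0] by (meson dvd_trans dvd_power zero_less_numeral)
      then have "r ^ 3 mod int p = r0 ^ 3 mod int p" by (simp add: mod_eq_dvd_iff)
      then have "[(r mod int p) ^ 3 = r0 ^ 3 mod int p] (mod int p)"
        by (simp add: cong_def power_mod)
      then have "[int (?f r ^ 3) = int c] (mod int p)"
        using pos by (simp add: c_def)
      then show "[?f r ^ 3 = c] (mod p)" using cong_int_iff by blast
    qed
  qed simp
  also have "\<dots> \<le> 3" using roots_mod_prime_bound[OF p] by simp
  finally show ?thesis .
qed

lemma card_bad_column:
  fixes p :: nat and B :: real
  assumes p: "prime p" and p5: "p \<ge> 5" and a: "\<not> int p dvd a" and B: "B > 0"
  shows "finite {b. \<bar>of_int b\<bar> < B \<and> (int p)\<^sup>2 dvd qdisc a b}"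
    and "real (card {b. \<bar>of_int b\<bar> < B \<and> (int p)\<^sup>2 dvd qdisc a b}) \<le> 3 * (2 * B / (real p)\<^sup>2 + 1)"
proof -
  let ?R = "{r \<in> {0..<(int p)\<^sup>2}. (int p)\<^sup>2 dvd qdisc a r}"
  let ?V = "{b. \<bar>of_int b\<bar> < B \<and> (int p)\<^sup>2 dvd qdisc a b}"
  let ?C = "\<lambda>r. {b::int. \<bar>of_int b\<bar> < B \<and> b mod (int p)\<^sup>2 = r mod (int p)\<^sup>2}"
  have pos: "(int p)\<^sup>2 > 0" using p5 by simp
  note C = card_residue_class[OF pos B]
  have finR: "finite ?R" by (rule finite_subset[of _ "{0..<(int p)\<^sup>2}"]) auto
  have sub: "?V \<subseteq> (\<Union>r\<in>?R. ?C r)"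
  proof
    fix b assume b: "b \<in> ?V"
    have "(int p)\<^sup>2 dvd qdisc a (b mod (int p)\<^sup>2)"
      using b dvd_qdisc_mod[of "(int p)\<^sup>2" a b] dvd_qdisc_mod[of "(int p)\<^sup>2" a "b mod (int p)\<^sup>2"]
      by simp
    then have "b mod (int p)\<^sup>2 \<in> ?R" using pos by simp
    then show "b \<in> (\<Union>r\<in>?R. ?C r)" using b by (intro UN_I[of "b mod (int p)\<^sup>2"]) simp_all
  qed
  have fin: "finite (\<Union>r\<in>?R. ?C r)" using finR C(1) by blast
  then show "finite ?V" using sub finite_subset by blast
  have "real (card ?V) \<le> real (card (\<Union>r\<in>?R. ?C r))"
    using card_mono[OF fin sub] by simp
  also have "\<dots> \<le> (\<Sum>r\<in>?R. real (card (?C r)))" by (rule real_card_UN_le[OF finR])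
  also have "\<dots> \<le> (\<Sum>r\<in>?R. 2 * B / (int p)\<^sup>2 + 1)" by (intro sum_mono C(2))
  also have "\<dots> = real (card ?R) * (2 * B / (int p)\<^sup>2 + 1)" by simp
  also have "\<dots> \<le> 3 * (2 * B / (int p)\<^sup>2 + 1)"
    using card_residues_qdisc[OF p p5 a] B by (intro mult_right_mono) (auto intro!: add_nonneg_nonneg)
  finally show "real (card ?V) \<le> 3 * (2 * B / (real p)\<^sup>2 + 1)"
    by simp
qed

text \<open>Telescoping, as 1 / n^2 is at most 1 / (n - 1) - 1 / n.\<close>

lemma sum_inverse_squares_le:
  assumes "z > 0"
  shows "(\<Sum>n\<in>{z<..N::nat}. 1 / (real n)\<^sup>2) \<le> 1 / real z"
proof (cases "z \<le> N")
  case True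
  then have "(\<Sum>n\<in>{z<..N}. 1 / (real n)\<^sup>2) \<le> 1 / real z - 1 / real N"
  proof (induction N rule: dec_induct)
    case (step n)
    have "{z<..Suc n} = insert (Suc n) {z<..n}" using step by auto
    then have "(\<Sum>n\<in>{z<..Suc n}. 1 / (real n)\<^sup>2) \<le> 1 / real z - 1 / real n + 1 / (real (Suc n))\<^sup>2"
      using step by simp
    also have "1 / (real (Suc n))\<^sup>2 \<le> 1 / (real n * real (Suc n))"
      using step assms by (intro divide_left_mono) (auto simp: power2_eq_square)
    also have "1 / (real n * real (Suc n)) = 1 / real n - 1 / real (Suc n)"
      using step assms by (simp add: field_simps)
    finally show ?case by simp
  qed simp
  then show ?thesis by (smt (verit) divide_nonneg_nonneg of_nat_0_le_iff)
qed simp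

text \<open>Zero accounts for the extra 1 in the bound for a residue class; removing it leaves a
  bound proportional to 1 / n.\<close>

lemma card_nonzero_multiples_le:
  assumes "A > 0" "n > 0"
  shows "finite {a::int. \<bar>of_int a\<bar> < A \<and> a \<noteq> 0 \<and> int n dvd a}"
    and "real (card {a::int. \<bar>of_int a\<bar> < A \<and> a \<noteq> 0 \<and> int n dvd a}) \<le> 2 * A / real n"
proof -
  let ?S = "{a::int. \<bar>of_int a\<bar> < A \<and> a \<noteq> 0 \<and> int n dvd a}"
  have ins: "insert 0 ?S = {a::int. \<bar>of_int a\<bar> < A \<and> a mod int n = 0 mod int n}"
    using assms by auto
  have C: "finite (insert 0 ?S)" "real (card (insert 0 ?S)) \<le> 2 * A / real n + 1"
    unfolding ins using card_residue_class[of "int n" A 0] assms by auto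
  show "finite ?S" using C(1) by simp
  then show "real (card ?S) \<le> 2 * A / real n" using C(2) by simp
qed

text \<open>If \<open>p\<close> divides \<open>a\<close>, it divides \<open>b\<close> as well, and
  \<open>a \<noteq> 0\<close> forces \<open>p\<close> to be at most \<open>A\<close>; these pairs
  contribute O(A B / p^2), summed over all integers above \<open>z\<close>. If \<open>p\<close> does
  not divide \<open>a\<close>, each of at most 2 A columns holds at most 3 (2 B / p^2 + 1) values of
  \<open>b\<close>, and the summands 1 for p up to \<open>Y\<close> add up to 6 A Y.\<close>

lemma card_medium_primes_le:
  fixes A B Y :: real and z :: nat
  assumes A: "A > 0" and AB: "A \<le> B" and z: "z \<ge> 5" and Y: "Y \<ge> 0"
  defines "T \<equiv> {(a, b). \<bar>of_int a\<bar> < A \<and> \<bar>of_int b\<bar> < B \<and> a \<noteq> 0 \<and>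
    (\<exists>p. prime p \<and> z < p \<and> (real p \<le> Y \<or> int p dvd a) \<and> (int p)\<^sup>2 dvd qdisc a b)}"
  shows "finite T" and "real (card T) \<le> 18 * A * B / z + 6 * A * Y"
proof -
  define I where "I n = {a::int. \<bar>of_int a\<bar> < A \<and> a \<noteq> 0 \<and> int n dvd a}" for n
  define J where "J n = {b::int. \<bar>of_int b\<bar> < B \<and> b mod int n = 0 mod int n}" for n
  define V where "V p a = {b::int. \<bar>of_int b\<bar> < B \<and> (int p)\<^sup>2 dvd qdisc a b}" for p a
  define S1 where "S1 = {z<..nat \<lfloor>A\<rfloor>}"
  define S2 where "S2 = {p\<in>{z<..nat \<lfloor>Y\<rfloor>}. prime p}"
  have B: "B > 0" using A AB by simp
  have fin12: "finite S1" "finite S2" by (auto simp: S1_def S2_def)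
  note I = card_nonzero_multiples_le[OF A, folded I_def]
  have J: "finite (J n)" "real (card (J n)) \<le> 3 * B / n" if "n \<in> S1" for n
  proof -
    have n: "n > 0" "real n \<le> A" using that z A by (auto simp: S1_def le_nat_floor le_nat_iff le_floor_iff)
    have "int n > 0" using n by simp
    note C = card_residue_class[OF this B, of 0, folded J_def]
    show "finite (J n)" by (rule C)
    \<comment> \<open>As n is at most A and hence at most B, the extra 1 is absorbed into B /
      n.\<close>
    have "1 \<le> B / n" using n AB by simp
    then show "real (card (J n)) \<le> 3 * B / n" using C(2) by simp
  qed
  let ?T1 = "\<Union>n\<in>S1. I n \<times> J n"
  let ?T2 = "\<Union>p\<in>S2. \<Union>a\<in>{a\<in>I 1. \<not> int p dvd a}. {a} \<times> V p a"
  have V: "finite (V p a)" "real (card (V p a)) \<le> 3 * (2 * B / (real p)\<^sup>2 + 1)"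
    if "p \<in> S2" "\<not> int p dvd a" for p a
    using card_bad_column[of p a B, folded V_def] that z B by (auto simp: S2_def)
  have sub: "T \<subseteq> ?T1 \<union> ?T2"
  proof
    fix x assume "x \<in> T"
    then obtain a b p where x: "x = (a, b)" "\<bar>of_int a\<bar> < A" "\<bar>of_int b\<bar> < B" "a \<noteq> 0" "prime p"
      "z < p" "real p \<le> Y \<or> int p dvd a" "(int p)\<^sup>2 dvd qdisc a b"
      by (auto simp: T_def)
    show "x \<in> ?T1 \<union> ?T2"
    proof (cases "int p dvd a")
      case True
      have "int p \<le> \<bar>a\<bar>" using True x(4) by (meson zdvd_imp_le dvd_abs_iff zero_less_abs_iff)
      then have "real p \<le> A" using x(2) by linarith
      then have "p \<in> S1" using x(6) by (auto simp: S1_def le_nat_floor)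
      moreover have "int p dvd b"
        using prime_sq_dvd_qdisc_imp[of "int p" a b] True x z by simp
      ultimately show ?thesis using x True by (auto simp: I_def J_def)
    next
      case False
      then have "p \<in> S2" using x by (auto simp: S2_def le_nat_floor)
      then show ?thesis using x False by (auto simp: I_def V_def)
    qed
  qed
  have f1: "finite ?T1" using fin12 J I(1) z by (auto simp: S1_def)
  have f2: "finite ?T2"
    using fin12 V I(1)[of 1] by (intro finite_UN_I finite_cartesian_product) auto
  show "finite T" using sub f1 f2 finite_subset by blast
  have "real (card ?T1) \<le> (\<Sum>n\<in>S1. real (card (I n)) * real (card (J n)))"
    using real_card_UN_le[OF fin12(1), of "\<lambda>n. I n \<times> J n"] by (simp add: card_cartesian_product)
  also have "\<dots> \<le> (\<Sum>n\<in>S1. (2 * A / n) * (3 * B / n))"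
    using I(2) J A z by (intro sum_mono mult_mono) (auto simp: S1_def)
  also have "\<dots> = 6 * A * B * (\<Sum>n\<in>S1. 1 / (real n)\<^sup>2)"
    unfolding sum_distrib_left by (intro sum.cong) (auto simp: power2_eq_square)
  also have "\<dots> \<le> 6 * A * B * (1 / z)"
    using A B z unfolding S1_def by (intro mult_left_mono sum_inverse_squares_le) auto
  finally have c1: "real (card ?T1) \<le> 6 * A * B / z" by simp
  have inner: "real (card (\<Union>a\<in>{a\<in>I 1. \<not> int p dvd a}. {a} \<times> V p a)) \<le>
      2 * A * (3 * (2 * B / (real p)\<^sup>2 + 1))" if p: "p \<in> S2" for p
  proof -
    let ?E = "{a\<in>I 1. \<not> int p dvd a}"
    have finE: "finite ?E" using I(1)[of 1] by simp
    have "real (card (\<Union>a\<in>?E. {a} \<times> V p a)) \<le> (\<Sum>a\<in>?E. real (card (V p a)))"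
      using real_card_UN_le[OF finE, of "\<lambda>a. {a} \<times> V p a"] by (simp add: card_cartesian_product)
    also have "\<dots> \<le> (\<Sum>a\<in>?E. 3 * (2 * B / (real p)\<^sup>2 + 1))"
      using V[OF p] by (intro sum_mono) auto
    also have "\<dots> = real (card ?E) * (3 * (2 * B / (real p)\<^sup>2 + 1))" by simp
    also have "\<dots> \<le> 2 * A * (3 * (2 * B / (real p)\<^sup>2 + 1))"
    proof (rule mult_right_mono)
      have "card ?E \<le> card (I 1)" using I(1)[of 1] by (intro card_mono) auto
      then show "real (card ?E) \<le> 2 * A" using I(2)[of 1] by simp
    qed (use B in \<open>auto intro!: add_nonneg_nonneg\<close>)
    finally show ?thesis .
  qed
  have cS2: "real (card S2) \<le> Y"
  proof -
    have "card S2 \<le> card {0<..nat \<lfloor>Y\<rfloor>}" unfolding S2_def by (intro card_mono) auto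
    then show ?thesis using Y by (simp add: of_nat_floor) linarith
  qed
  have "real (card ?T2) \<le> (\<Sum>p\<in>S2. real (card (\<Union>a\<in>{a\<in>I 1. \<not> int p dvd a}. {a} \<times> V p a)))"
    by (rule real_card_UN_le[OF fin12(2)])
  also have "\<dots> \<le> (\<Sum>p\<in>S2. 2 * A * (3 * (2 * B / (real p)\<^sup>2 + 1)))"
    by (intro sum_mono inner)
  also have "\<dots> = (\<Sum>p\<in>S2. 12 * A * B * (1 / (real p)\<^sup>2) + 6 * A)"
    by (intro sum.cong) (auto simp: algebra_simps)
  also have "\<dots> = 12 * A * B * (\<Sum>p\<in>S2. 1 / (real p)\<^sup>2) + real (card S2) * (6 * A)"
    by (simp add: sum.distrib sum_distrib_left)
  also have "\<dots> \<le> 12 * A * B * (1 / z) + Y * (6 * A)"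
  proof (intro add_mono mult_left_mono mult_right_mono cS2)
    have "(\<Sum>p\<in>S2. 1 / (real p)\<^sup>2) \<le> (\<Sum>p\<in>{z<..nat \<lfloor>Y\<rfloor>}. 1 / (real p)\<^sup>2)"
      unfolding S2_def by (intro sum_mono2) auto
    also have "\<dots> \<le> 1 / z" using z by (intro sum_inverse_squares_le) auto
    finally show "(\<Sum>p\<in>S2. 1 / (real p)\<^sup>2) \<le> 1 / z" .
  qed (use A B in auto)
  finally have c2: "real (card ?T2) \<le> 12 * A * B / z + 6 * A * Y"
    by (simp add: mult.commute[of Y])
  have "card T \<le> card (?T1 \<union> ?T2)"
    by (rule card_mono[OF _ sub]) (use f1 f2 in blast)
  also have "\<dots> \<le> card ?T1 + card ?T2" by (rule card_Un_le)
  finally have "real (card T) \<le> real (card ?T1) + real (card ?T2)" by linarith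
  also have "\<dots> \<le> 18 * A * B / z + 6 * A * Y" using c1 c2 by simp
  finally show "real (card T) \<le> 18 * A * B / z + 6 * A * Y" .
qed

section \<open>Reduction of the resolvent cubic\<close>

text \<open>Lagrange reduction of the lattice of vectors (p x + r y, W y), whose covolume is p W;
  \<open>q\<close> is the squared length. A basis minimising the sum of the two squared lengths
  takes the place of the reduction algorithm.\<close>

lemma reduced_basis:
  fixes p r W :: int
  assumes p: "p > 0" and W: "W > 0"
  defines "q \<equiv> \<lambda>x y. (p * x + r * y)\<^sup>2 + W\<^sup>2 * y\<^sup>2"
  shows "\<exists>x1 y1 x2 y2. x1 * y2 - x2 * y1 = 1 \<and> q x1 y1 \<le> q x2 y2 \<and>
    3 * (q x1 y1 * q x2 y2) \<le> 4 * (p * W)\<^sup>2"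
proof -
  let ?P = "\<lambda>(x1, y1, x2, y2). x1 * y2 - x2 * y1 = (1::int)"
  let ?m = "\<lambda>(x1, y1, x2, y2). nat (q x1 y1 + q x2 y2)"
  have q0: "q x y \<ge> 0" for x y by (simp add: q_def)
  have "?P (1, 0, 0, 1)" by simp
  then obtain v where v: "?P v" "\<And>w. ?P w \<Longrightarrow> ?m v \<le> ?m w"
    using ex_has_least_nat[of ?P _ ?m] by blast
  obtain x1 y1 x2 y2 where vv: "v = (x1, y1, x2, y2)" by (cases v) auto
  have det: "x1 * y2 - x2 * y1 = 1" using v vv by simp
  have min: "q x1 y1 + q x2 y2 \<le> q u1 w1 + q u2 w2" if "u1 * w2 - u2 * w1 = 1" for u1 w1 u2 w2
    using v(2)[of "(u1, w1, u2, w2)"] that vv q0[of u1 w1] q0[of u2 w2] by simp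
  \<comment> \<open>The inner product of the two basis vectors. Adding one vector to the other, or
    subtracting it, cannot lower the minimal sum, so 2 |B| is at most either squared length.\<close>
  define B where "B = (p * x1 + r * y1) * (p * x2 + r * y2) + W\<^sup>2 * (y1 * y2)"
  have 1: "q (x2 + x1) (y2 + y1) = q x2 y2 + 2 * B + q x1 y1"
    "q (x2 - x1) (y2 - y1) = q x2 y2 - 2 * B + q x1 y1"
    "q (x1 - x2) (y1 - y2) = q x2 y2 - 2 * B + q x1 y1"
    "q (x1 + x2) (y1 + y2) = q x2 y2 + 2 * B + q x1 y1"
    unfolding q_def B_def by Groebner_Basis.algebra+
  have "\<bar>2 * B\<bar> \<le> q x1 y1"
    using min[of x1 "y2 + y1" "x2 + x1" y1] min[of x1 "y2 - y1" "x2 - x1" y1] det 1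
    by (simp add: algebra_simps)
  moreover have "\<bar>2 * B\<bar> \<le> q x2 y2"
    using min[of "x1 + x2" y2 x2 "y1 + y2"] min[of "x1 - x2" y2 x2 "y1 - y2"] det 1
    by (simp add: algebra_simps)
  ultimately have "\<bar>2 * B\<bar> * \<bar>2 * B\<bar> \<le> q x1 y1 * q x2 y2"
    using q0 by (intro mult_mono) auto
  then have B: "4 * B\<^sup>2 \<le> q x1 y1 * q x2 y2"
    by (simp add: abs_mult_self_eq power2_eq_square)
  \<comment> \<open>Lagrange's identity: the Gram determinant is the squared covolume.\<close>
  have "q x1 y1 * q x2 y2 = B\<^sup>2 + (p * W)\<^sup>2 * (x1 * y2 - x2 * y1)\<^sup>2"
    unfolding q_def B_def by Groebner_Basis.algebra
  then have bound: "3 * (q x1 y1 * q x2 y2) \<le> 4 * (p * W)\<^sup>2"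
    using B det by simp
  show ?thesis
  proof (cases "q x1 y1 \<le> q x2 y2")
    case True
    then show ?thesis using det bound by blast
  next
    case False
    \<comment> \<open>Exchanging the vectors and negating one of them preserves determinant
      1.\<close>
    have neg: "q (- x1) (- y1) = q x1 y1" unfolding q_def by Groebner_Basis.algebra
    show ?thesis
      using det bound False neg
      by (intro exI[of _ x2] exI[of _ y2] exI[of _ "- x1"] exI[of _ "- y1"])
        (auto simp: mult.commute)
  qed
qed

text \<open>The resolvent cubic \<open>x\<^sup>3 - 4 b x + a\<^sup>2\<close> of \<open>x\<^sup>4 + a x + b\<close> has the same discriminant up
  to a constant. If \<open>p\<^sup>2\<close> divides it, the cubic has a root \<open>r\<close> modulo \<open>p\<^sup>2\<close> that is double
  modulo \<open>p\<close>, so the binary form \<open>p\<^sup>-\<^sup>2 f(p x + r y, y)\<close> is integral.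
  Below, \<open>\<alpha>\<close>, \<open>\<beta>\<close>, \<open>\<gamma>\<close>, \<open>\<delta>\<close> are its coefficients in another basis, and \<open>m\<^sub>i = p x\<^sub>i + r y\<^sub>i\<close>.\<close>

definition cubic_data ::
    "int \<Rightarrow> int \<Rightarrow> int \<Rightarrow> int \<Rightarrow> int \<Rightarrow> int \<Rightarrow> int \<Rightarrow> int \<times> int \<times> int \<times> int \<Rightarrow> bool" where
  "cubic_data a b p m1 y1 m2 y2 = (\<lambda>(\<alpha>, \<beta>, \<gamma>, \<delta>).
     m1 * y2 - m2 * y1 = p \<and>
     p\<^sup>2 * \<alpha> = m1 ^ 3 - 4 * b * m1 * y1\<^sup>2 + a\<^sup>2 * y1 ^ 3 \<and>
     p\<^sup>2 * \<beta> = 3 * m1\<^sup>2 * m2 - 4 * b * (m2 * y1\<^sup>2 + 2 * m1 * y1 * y2) + 3 * a\<^sup>2 * y1\<^sup>2 * y2 \<and>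
     p\<^sup>2 * \<gamma> = 3 * m1 * m2\<^sup>2 - 4 * b * (m1 * y2\<^sup>2 + 2 * m2 * y1 * y2) + 3 * a\<^sup>2 * y1 * y2\<^sup>2 \<and>
     p\<^sup>2 * \<delta> = m2 ^ 3 - 4 * b * m2 * y2\<^sup>2 + a\<^sup>2 * y2 ^ 3)"

text \<open>A double root of x^3 - 4 b x + a^2 equals 3 a^2 / (8 b). For this \<open>r\<close>, 512
  b^3 times the value and 64 b^2 times the derivative are, modulo p^2, the discriminant times -a^2
  and -1 respectively.\<close>

lemma double_root_mod_sq:
  fixes p :: int
  assumes p: "prime p" "p \<ge> 5" and D: "p\<^sup>2 dvd qdisc a b" and a: "\<not> p dvd a"
  shows "\<exists>r. p\<^sup>2 dvd r ^ 3 - 4 * b * r + a\<^sup>2 \<and> p dvd 3 * r\<^sup>2 - 4 * b"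
proof -
  have b: "\<not> p dvd b" using prime_sq_dvd_qdisc_imp[OF p D] a by simp
  note nd = prime_ge_5_not_dvd[OF p]
  have cop: "coprime x (p\<^sup>2)" if "\<not> p dvd x" for x
    using that p by (simp add: coprime_commute prime_imp_coprime)
  have "\<not> p dvd 2 * 4 * b" using nd b p by (simp only: prime_dvd_mult_iff) simp
  then obtain c where c: "[8 * b * c = 1] (mod p\<^sup>2)"
    using cong_solve_coprime_int[OF cop, of "8 * b"] by auto
  define r where "r = 3 * a\<^sup>2 * c"
  have "8 * b * r = 3 * a\<^sup>2 * (8 * b * c)" by (simp add: r_def)
  also have "[\<dots> = 3 * a\<^sup>2 * 1] (mod p\<^sup>2)" by (intro cong_mult cong_refl c)
  finally have "p\<^sup>2 dvd 8 * b * r - 3 * a\<^sup>2" by (simp add: cong_iff_dvd_diff)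
  then obtain k where k: "8 * b * r = 3 * a\<^sup>2 + p\<^sup>2 * k"
    by (metis dvd_def diff_eq_eq add.commute)
  from D obtain l where l: "256 * b ^ 3 = 27 * a ^ 4 + p\<^sup>2 * l"
    by (metis qdisc_def dvd_def diff_eq_eq add.commute)
  have "512 * b ^ 3 * (r ^ 3 - 4 * b * r + a\<^sup>2) =
      (8 * b * r) ^ 3 - 256 * b ^ 3 * (8 * b * r) + 512 * b ^ 3 * a\<^sup>2"
    by (simp add: power_mult_distrib algebra_simps)
  also have "\<dots> = p\<^sup>2 * (27 * a ^ 4 * k + 9 * a\<^sup>2 * p\<^sup>2 * k\<^sup>2 + p ^ 4 * k ^ 3
      - 27 * a ^ 4 * k - p\<^sup>2 * l * k - l * a\<^sup>2)"
    using k l by Groebner_Basis.algebra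
  finally have "p\<^sup>2 dvd 512 * b ^ 3 * (r ^ 3 - 4 * b * r + a\<^sup>2)" by simp
  moreover have "\<not> p dvd 2 * 256 * b ^ 3"
    using nd b p by (simp only: prime_dvd_mult_iff prime_dvd_power_iff) simp
  ultimately have 1: "p\<^sup>2 dvd r ^ 3 - 4 * b * r + a\<^sup>2"
    using coprime_dvd_mult_right_iff[of "p\<^sup>2" "512 * b ^ 3"] cop[of "512 * b ^ 3"]
    by (simp add: coprime_commute)
  have "64 * b\<^sup>2 * (3 * r\<^sup>2 - 4 * b) = 3 * (8 * b * r)\<^sup>2 - 256 * b ^ 3"
    by (simp add: power_mult_distrib algebra_simps power_numeral_reduce)
  also have "\<dots> = p\<^sup>2 * (18 * a\<^sup>2 * k + 3 * p\<^sup>2 * k\<^sup>2 - l)"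
    using k l by Groebner_Basis.algebra
  finally have "p dvd 64 * b\<^sup>2 * (3 * r\<^sup>2 - 4 * b)"
    by (metis dvd_mult2 dvd_triv_left power2_eq_square)
  moreover have "\<not> p dvd 4 * 4 * 4 * b\<^sup>2"
    using nd b p by (simp only: prime_dvd_mult_iff prime_dvd_power_iff) simp
  ultimately have 2: "p dvd 3 * r\<^sup>2 - 4 * b"
    using prime_dvd_mult_iff[OF p(1), of "64 * b\<^sup>2" "3 * r\<^sup>2 - 4 * b"] by simp
  from 1 2 show ?thesis by blast
qed

text \<open>Let f be the resolvent, f(r) = p^2 t and f'(r) = p s. Taylor expansion gives f(p x + r
  y, y) / p^2 = p x^3 + 3 r x^2 y + s x y^2 + t y^3, and the witness is this form written in the
  reduced basis. The clause on \<open>y1 = 0\<close> later excludes that case for large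
  \<open>p\<close>.\<close>

lemma cubic_data_exists:
  fixes p W :: int
  assumes p: "prime p" "p \<ge> 5" and D: "p\<^sup>2 dvd qdisc a b" and a: "\<not> p dvd a" and W: "W > 0"
  shows "\<exists>m1 y1 m2 y2 F. cubic_data a b p m1 y1 m2 y2 F \<and>
    (y1 = 0 \<longrightarrow> p\<^sup>2 \<le> m1\<^sup>2) \<and>
    m1\<^sup>2 + W\<^sup>2 * y1\<^sup>2 \<le> m2\<^sup>2 + W\<^sup>2 * y2\<^sup>2 \<and>
    3 * ((m1\<^sup>2 + W\<^sup>2 * y1\<^sup>2) * (m2\<^sup>2 + W\<^sup>2 * y2\<^sup>2)) \<le> 4 * (p * W)\<^sup>2"
proof -
  obtain r s t where r: "r ^ 3 - 4 * b * r + a\<^sup>2 = p\<^sup>2 * t" "3 * r\<^sup>2 - 4 * b = p * s"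
    using double_root_mod_sq[OF p D a] by (auto simp: dvd_def)
  have "p > 0" using p by simp
  from reduced_basis[OF this W, of r] obtain x1 y1 x2 y2 where
    det: "x1 * y2 - x2 * y1 = 1" and
    red: "(p * x1 + r * y1)\<^sup>2 + W\<^sup>2 * y1\<^sup>2 \<le> (p * x2 + r * y2)\<^sup>2 + W\<^sup>2 * y2\<^sup>2"
    "3 * (((p * x1 + r * y1)\<^sup>2 + W\<^sup>2 * y1\<^sup>2) * ((p * x2 + r * y2)\<^sup>2 + W\<^sup>2 * y2\<^sup>2)) \<le> 4 * (p * W)\<^sup>2"
    by blast
  have a2: "a\<^sup>2 = p\<^sup>2 * t - r ^ 3 + 4 * b * r" and b4: "4 * b = 3 * r\<^sup>2 - p * s"
    using r by auto
  have "cubic_data a b p (p * x1 + r * y1) y1 (p * x2 + r * y2) y2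
    (p * x1 ^ 3 + 3 * r * x1\<^sup>2 * y1 + s * x1 * y1\<^sup>2 + t * y1 ^ 3,
     3 * p * x1\<^sup>2 * x2 + 3 * r * (x1\<^sup>2 * y2 + 2 * x1 * x2 * y1) + s * (x2 * y1\<^sup>2 + 2 * x1 * y1 * y2)
       + 3 * t * y1\<^sup>2 * y2,
     3 * p * x1 * x2\<^sup>2 + 3 * r * (x2\<^sup>2 * y1 + 2 * x1 * x2 * y2) + s * (x1 * y2\<^sup>2 + 2 * x2 * y1 * y2)
       + 3 * t * y1 * y2\<^sup>2,
     p * x2 ^ 3 + 3 * r * x2\<^sup>2 * y2 + s * x2 * y2\<^sup>2 + t * y2 ^ 3)"
    unfolding cubic_data_def prod.case
  proof (intro conjI)
    show "(p * x1 + r * y1) * y2 - (p * x2 + r * y2) * y1 = p" using det by Groebner_Basis.algebra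
  qed (unfold a2 b4; Groebner_Basis.algebra)+
  moreover have "p\<^sup>2 \<le> (p * x1 + r * y1)\<^sup>2" if "y1 = 0"
  proof -
    have "x1 * y2 = 1" using det that by simp
    then have "x1\<^sup>2 = 1" by (auto simp: zmult_eq_1_iff)
    then show ?thesis using that by (simp add: power_mult_distrib)
  qed
  ultimately show ?thesis using red by blast
qed

text \<open>Composing \<open>F\<close> with the adjugate of the basis matrix gives p times the
  resolvent. Thus F(y2, -y1) = p, the partial derivatives of \<open>F\<close> at (y2, -y1) are 3 m1
  and 3 m2, and once the m's are known the remaining coefficients p a^2 and -4 p b can be read off.
  The sign of \<open>a\<close> is lost.\<close>

lemma cubic_data_inj:
  assumes 1: "cubic_data a b p m1 y1 m2 y2 F" and 2: "cubic_data a' b' p' m1' y1 m2' y2 F"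
    and p: "p \<noteq> 0" "p' \<noteq> 0"
  shows "a\<^sup>2 = a'\<^sup>2" "b = b'"
proof -
  obtain \<alpha> \<beta> \<gamma> \<delta> where F: "F = (\<alpha>, \<beta>, \<gamma>, \<delta>)" by (cases F) auto
  have rec: "p = \<alpha> * y2 ^ 3 - \<beta> * y2\<^sup>2 * y1 + \<gamma> * y2 * y1\<^sup>2 - \<delta> * y1 ^ 3"
    "3 * m1 = 3 * \<alpha> * y2\<^sup>2 - 2 * \<beta> * y2 * y1 + \<gamma> * y1\<^sup>2"
    "3 * m2 = \<beta> * y2\<^sup>2 - 2 * \<gamma> * y2 * y1 + 3 * \<delta> * y1\<^sup>2"
    "p * a\<^sup>2 = - \<alpha> * m2 ^ 3 + \<beta> * m2\<^sup>2 * m1 - \<gamma> * m2 * m1\<^sup>2 + \<delta> * m1 ^ 3"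
    "- (4 * p * b) = 3 * \<alpha> * y2 * m2\<^sup>2 - \<beta> * (2 * y2 * m2 * m1 + m2\<^sup>2 * y1)
       + \<gamma> * (y2 * m1\<^sup>2 + 2 * m2 * y1 * m1) - 3 * \<delta> * y1 * m1\<^sup>2"
    if c: "cubic_data a b p m1 y1 m2 y2 F" and p: "p \<noteq> 0" for a b p m1 m2
  proof -
    have det: "m1 * y2 - m2 * y1 = p"
      and co: "p\<^sup>2 * \<alpha> = m1 ^ 3 - 4 * b * m1 * y1\<^sup>2 + a\<^sup>2 * y1 ^ 3"
        "p\<^sup>2 * \<beta> = 3 * m1\<^sup>2 * m2 - 4 * b * (m2 * y1\<^sup>2 + 2 * m1 * y1 * y2) + 3 * a\<^sup>2 * y1\<^sup>2 * y2"
        "p\<^sup>2 * \<gamma> = 3 * m1 * m2\<^sup>2 - 4 * b * (m1 * y2\<^sup>2 + 2 * m2 * y1 * y2) + 3 * a\<^sup>2 * y1 * y2\<^sup>2"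
        "p\<^sup>2 * \<delta> = m2 ^ 3 - 4 * b * m2 * y2\<^sup>2 + a\<^sup>2 * y2 ^ 3"
      using c by (auto simp: cubic_data_def F)
    have p2: "p\<^sup>2 \<noteq> 0" using p by simp
    have lin: "p\<^sup>2 * (\<alpha> * A + \<beta> * B + \<gamma> * C + \<delta> * D) =
        (p\<^sup>2 * \<alpha>) * A + (p\<^sup>2 * \<beta>) * B + (p\<^sup>2 * \<gamma>) * C + (p\<^sup>2 * \<delta>) * D" for A B C D
      by Groebner_Basis.algebra
    \<comment> \<open>All five claims are linear in the coefficients of the form. Multiplied by p^2,
      with \<open>p\<close> written as the determinant, they become polynomial identities.\<close>
    have key: "X = \<alpha> * A + \<beta> * B + \<gamma> * C + \<delta> * D"
      if "(m1 * y2 - m2 * y1)\<^sup>2 * X =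
        (m1 ^ 3 - 4 * b * m1 * y1\<^sup>2 + a\<^sup>2 * y1 ^ 3) * A +
        (3 * m1\<^sup>2 * m2 - 4 * b * (m2 * y1\<^sup>2 + 2 * m1 * y1 * y2) + 3 * a\<^sup>2 * y1\<^sup>2 * y2) * B +
        (3 * m1 * m2\<^sup>2 - 4 * b * (m1 * y2\<^sup>2 + 2 * m2 * y1 * y2) + 3 * a\<^sup>2 * y1 * y2\<^sup>2) * C +
        (m2 ^ 3 - 4 * b * m2 * y2\<^sup>2 + a\<^sup>2 * y2 ^ 3) * D" for X A B C D
    proof -
      have "p\<^sup>2 * X = p\<^sup>2 * (\<alpha> * A + \<beta> * B + \<gamma> * C + \<delta> * D)"
        unfolding lin co using that by (simp only: det)
      then show ?thesis using p2 by simp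
    qed
    have "m1 * y2 - m2 * y1 = \<alpha> * y2 ^ 3 + \<beta> * (- (y2\<^sup>2 * y1)) + \<gamma> * (y2 * y1\<^sup>2) + \<delta> * (- (y1 ^ 3))"
      by (rule key) Groebner_Basis.algebra
    then show "p = \<alpha> * y2 ^ 3 - \<beta> * y2\<^sup>2 * y1 + \<gamma> * y2 * y1\<^sup>2 - \<delta> * y1 ^ 3"
      unfolding det by (simp add: mult.assoc)
    have "3 * m1 = \<alpha> * (3 * y2\<^sup>2) + \<beta> * (- (2 * y2 * y1)) + \<gamma> * y1\<^sup>2 + \<delta> * 0"
      by (rule key) Groebner_Basis.algebra
    then show "3 * m1 = 3 * \<alpha> * y2\<^sup>2 - 2 * \<beta> * y2 * y1 + \<gamma> * y1\<^sup>2" by Groebner_Basis.algebra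
    have "3 * m2 = \<alpha> * 0 + \<beta> * y2\<^sup>2 + \<gamma> * (- (2 * y2 * y1)) + \<delta> * (3 * y1\<^sup>2)"
      by (rule key) Groebner_Basis.algebra
    then show "3 * m2 = \<beta> * y2\<^sup>2 - 2 * \<gamma> * y2 * y1 + 3 * \<delta> * y1\<^sup>2" by Groebner_Basis.algebra
    have "(m1 * y2 - m2 * y1) * a\<^sup>2 =
        \<alpha> * (- (m2 ^ 3)) + \<beta> * (m2\<^sup>2 * m1) + \<gamma> * (- (m2 * m1\<^sup>2)) + \<delta> * m1 ^ 3"
      by (rule key) Groebner_Basis.algebra
    then show "p * a\<^sup>2 = - \<alpha> * m2 ^ 3 + \<beta> * m2\<^sup>2 * m1 - \<gamma> * m2 * m1\<^sup>2 + \<delta> * m1 ^ 3"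
      unfolding det by Groebner_Basis.algebra
    have "- (4 * (m1 * y2 - m2 * y1) * b) =
        \<alpha> * (3 * y2 * m2\<^sup>2) + \<beta> * (- (2 * y2 * m2 * m1 + m2\<^sup>2 * y1))
       + \<gamma> * (y2 * m1\<^sup>2 + 2 * m2 * y1 * m1) + \<delta> * (- (3 * y1 * m1\<^sup>2))"
      by (rule key) Groebner_Basis.algebra
    then show "- (4 * p * b) = 3 * \<alpha> * y2 * m2\<^sup>2 - \<beta> * (2 * y2 * m2 * m1 + m2\<^sup>2 * y1)
       + \<gamma> * (y2 * m1\<^sup>2 + 2 * m2 * y1 * m1) - 3 * \<delta> * y1 * m1\<^sup>2"
      unfolding det by Groebner_Basis.algebra
  qed
  note r1 = rec[OF 1 p(1)] and r2 = rec[OF 2 p(2)]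
  have pp: "p' = p" using r1(1) r2(1) by simp
  have "3 * m1 = 3 * m1'" "3 * m2 = 3 * m2'" using r1(2,3) r2(2,3) by simp_all
  then have m: "m1' = m1" "m2' = m2" by simp_all
  have "p * a\<^sup>2 = p * a'\<^sup>2" using r1(4) r2(4) unfolding pp m by simp
  then show "a\<^sup>2 = a'\<^sup>2" using p by simp
  have "- (4 * p * b) = - (4 * p * b')" unfolding r1(5) using r2(5) unfolding pp m by simp
  then show "b = b'" using p by simp
qed

section \<open>Counting reduced cubics\<close>

text \<open>For \<open>R \<ge> 1\<close> the 1 in 2 R + 1 is absorbed, so that several such bounds
  can be multiplied without lower order terms.\<close>

lemma card_int_abs_le:
  fixes R :: real
  assumes "R \<ge> 1"
  shows "finite {x::int. \<bar>of_int x\<bar> \<le> R}" and "real (card {x::int. \<bar>of_int x\<bar> \<le> R}) \<le> 3 * R"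
proof -
  have eq: "{x::int. \<bar>of_int x\<bar> \<le> R} = {- \<lfloor>R\<rfloor>..\<lfloor>R\<rfloor>}"
    by (auto simp: abs_le_iff le_floor_iff) linarith+
  show "finite {x::int. \<bar>of_int x\<bar> \<le> R}" unfolding eq by simp
  have "real (card {x::int. \<bar>of_int x\<bar> \<le> R}) = of_int (2 * \<lfloor>R\<rfloor> + 1)"
    unfolding eq using assms by (simp add: of_nat_nat)
  then show "real (card {x::int. \<bar>of_int x\<bar> \<le> R}) \<le> 3 * R"
    using assms by (simp, linarith)
qed

text \<open>In units of \<open>W\<close>, b has weight 2 and a^2 has weight 3, matching their powers
  of y. As |m_i| and W |y_i| are at most L_i, each monomial is at most the corresponding product of
  three lengths; the constants are the coefficient sums 1 + 4 + 1 and 3 + 4 + 8 + 3.\<close>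

lemma cubic_data_bounds:
  fixes L1 L2 W :: real
  assumes c: "cubic_data a b p m1 y1 m2 y2 (\<alpha>, \<beta>, \<gamma>, \<delta>)"
    and a: "real_of_int (a\<^sup>2) \<le> W ^ 3" and b: "real_of_int \<bar>b\<bar> \<le> W\<^sup>2" and W: "W > 0"
    and L: "L1 \<ge> 0" "L2 \<ge> 0" "L1\<^sup>2 = real_of_int m1 ^ 2 + W\<^sup>2 * real_of_int y1 ^ 2"
      "L2\<^sup>2 = real_of_int m2 ^ 2 + W\<^sup>2 * real_of_int y2 ^ 2"
  shows "W * \<bar>real_of_int y1\<bar> \<le> L1" "W * \<bar>real_of_int y2\<bar> \<le> L2"
    "real_of_int p ^ 2 * \<bar>real_of_int \<alpha>\<bar> \<le> 6 * L1 ^ 3"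
    "real_of_int p ^ 2 * \<bar>real_of_int \<beta>\<bar> \<le> 18 * (L1\<^sup>2 * L2)"
    "real_of_int p ^ 2 * \<bar>real_of_int \<gamma>\<bar> \<le> 18 * (L1 * L2\<^sup>2)"
    "real_of_int p ^ 2 * \<bar>real_of_int \<delta>\<bar> \<le> 6 * L2 ^ 3"
proof -
  define A B n1 z1 n2 z2 where "A = real_of_int a ^ 2" and "B = real_of_int b"
    and "n1 = real_of_int m1" and "z1 = real_of_int y1"
    and "n2 = real_of_int m2" and "z2 = real_of_int y2"
  note defs = A_def B_def n1_def z1_def n2_def z2_def
  have y: "W * \<bar>z1\<bar> \<le> L1" "W * \<bar>z2\<bar> \<le> L2" and m: "\<bar>n1\<bar> \<le> L1" "\<bar>n2\<bar> \<le> L2"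
  proof -
    have "(W * \<bar>z1\<bar>)\<^sup>2 \<le> L1\<^sup>2" "\<bar>n1\<bar>\<^sup>2 \<le> L1\<^sup>2" "(W * \<bar>z2\<bar>)\<^sup>2 \<le> L2\<^sup>2" "\<bar>n2\<bar>\<^sup>2 \<le> L2\<^sup>2"
      unfolding L(3,4) defs by (simp_all add: power_mult_distrib)
    then show "W * \<bar>z1\<bar> \<le> L1" "W * \<bar>z2\<bar> \<le> L2" "\<bar>n1\<bar> \<le> L1" "\<bar>n2\<bar> \<le> L2"
      using L(1,2) power2_le_imp_le by blast+
  qed
  show "W * \<bar>real_of_int y1\<bar> \<le> L1" "W * \<bar>real_of_int y2\<bar> \<le> L2" using y by (auto simp: defs)
  have bm: "\<bar>B * (m * y * y')\<bar> \<le> M * Y * Y'"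
    if "\<bar>m\<bar> \<le> M" "W * \<bar>y\<bar> \<le> Y" "W * \<bar>y'\<bar> \<le> Y'" "M \<ge> 0" "Y \<ge> 0" "Y' \<ge> 0"
    for m y y' M Y Y' :: real
  proof -
    have "\<bar>B * (m * y * y')\<bar> = \<bar>B\<bar> * (\<bar>m\<bar> * \<bar>y\<bar> * \<bar>y'\<bar>)" by (simp add: abs_mult)
    also have "\<dots> \<le> W\<^sup>2 * (\<bar>m\<bar> * \<bar>y\<bar> * \<bar>y'\<bar>)"
      using b by (intro mult_right_mono) (auto simp: B_def)
    also have "\<dots> = \<bar>m\<bar> * (W * \<bar>y\<bar>) * (W * \<bar>y'\<bar>)" by (simp add: power2_eq_square)
    also have "\<dots> \<le> M * Y * Y'" using that W by (intro mult_mono) auto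
    finally show ?thesis .
  qed
  have am: "\<bar>A * (y * y' * y'')\<bar> \<le> Y * Y' * Y''"
    if "W * \<bar>y\<bar> \<le> Y" "W * \<bar>y'\<bar> \<le> Y'" "W * \<bar>y''\<bar> \<le> Y''" "Y \<ge> 0" "Y' \<ge> 0" "Y'' \<ge> 0"
    for y y' y'' Y Y' Y'' :: real
  proof -
    have "\<bar>A * (y * y' * y'')\<bar> = A * (\<bar>y\<bar> * \<bar>y'\<bar> * \<bar>y''\<bar>)" by (simp add: abs_mult A_def)
    also have "\<dots> \<le> W ^ 3 * (\<bar>y\<bar> * \<bar>y'\<bar> * \<bar>y''\<bar>)"
      using a by (intro mult_right_mono) (auto simp: A_def)
    also have "\<dots> = (W * \<bar>y\<bar>) * (W * \<bar>y'\<bar>) * (W * \<bar>y''\<bar>)" by (simp add: power3_eq_cube)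
    also have "\<dots> \<le> Y * Y' * Y''" using that W by (intro mult_mono) auto
    finally show ?thesis .
  qed
  have mm: "\<bar>m * m' * m''\<bar> \<le> M * M' * M''"
    if "\<bar>m\<bar> \<le> M" "\<bar>m'\<bar> \<le> M'" "\<bar>m''\<bar> \<le> M''" "M \<ge> 0" "M' \<ge> 0" "M'' \<ge> 0"
    for m m' m'' M M' M'' :: real
    unfolding abs_mult using that by (intro mult_mono) auto
  have co: "p\<^sup>2 * \<alpha> = m1 ^ 3 - 4 * b * m1 * y1\<^sup>2 + a\<^sup>2 * y1 ^ 3"
    "p\<^sup>2 * \<beta> = 3 * m1\<^sup>2 * m2 - 4 * b * (m2 * y1\<^sup>2 + 2 * m1 * y1 * y2) + 3 * a\<^sup>2 * y1\<^sup>2 * y2"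
    "p\<^sup>2 * \<gamma> = 3 * m1 * m2\<^sup>2 - 4 * b * (m1 * y2\<^sup>2 + 2 * m2 * y1 * y2) + 3 * a\<^sup>2 * y1 * y2\<^sup>2"
    "p\<^sup>2 * \<delta> = m2 ^ 3 - 4 * b * m2 * y2\<^sup>2 + a\<^sup>2 * y2 ^ 3"
    using c by (auto simp: cubic_data_def)
  have "real_of_int p ^ 2 * \<bar>real_of_int \<alpha>\<bar> = \<bar>real_of_int (p\<^sup>2 * \<alpha>)\<bar>" by (simp add: abs_mult)
  also have "\<dots> = \<bar>n1 * n1 * n1 - 4 * (B * (n1 * z1 * z1)) + A * (z1 * z1 * z1)\<bar>"
    unfolding co by (simp add: defs power2_eq_square power3_eq_cube algebra_simps)
  also have "\<dots> \<le> 6 * (L1 * L1 * L1)"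
    using mm[OF m(1) m(1) m(1) L(1) L(1) L(1)] bm[OF m(1) y(1) y(1) L(1) L(1) L(1)]
      am[OF y(1) y(1) y(1) L(1) L(1) L(1)] by linarith
  finally show "real_of_int p ^ 2 * \<bar>real_of_int \<alpha>\<bar> \<le> 6 * L1 ^ 3" by (simp add: power3_eq_cube)
  have "real_of_int p ^ 2 * \<bar>real_of_int \<delta>\<bar> = \<bar>real_of_int (p\<^sup>2 * \<delta>)\<bar>" by (simp add: abs_mult)
  also have "\<dots> = \<bar>n2 * n2 * n2 - 4 * (B * (n2 * z2 * z2)) + A * (z2 * z2 * z2)\<bar>"
    unfolding co by (simp add: defs power2_eq_square power3_eq_cube algebra_simps)
  also have "\<dots> \<le> 6 * (L2 * L2 * L2)"
    using mm[OF m(2) m(2) m(2) L(2) L(2) L(2)] bm[OF m(2) y(2) y(2) L(2) L(2) L(2)]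
      am[OF y(2) y(2) y(2) L(2) L(2) L(2)] by linarith
  finally show "real_of_int p ^ 2 * \<bar>real_of_int \<delta>\<bar> \<le> 6 * L2 ^ 3" by (simp add: power3_eq_cube)
  have "real_of_int p ^ 2 * \<bar>real_of_int \<beta>\<bar> = \<bar>real_of_int (p\<^sup>2 * \<beta>)\<bar>" by (simp add: abs_mult)
  also have "\<dots> = \<bar>3 * (n1 * n1 * n2) - 4 * (B * (n2 * z1 * z1)) - 8 * (B * (n1 * z1 * z2))
      + 3 * (A * (z1 * z1 * z2))\<bar>"
    unfolding co by (simp add: defs power2_eq_square power3_eq_cube algebra_simps)
  also have "\<dots> \<le> 18 * (L1 * L1 * L2)"
    using mm[OF m(1) m(1) m(2) L(1) L(1) L(2)] bm[OF m(2) y(1) y(1) L(2) L(1) L(1)]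
      bm[OF m(1) y(1) y(2) L(1) L(1) L(2)] am[OF y(1) y(1) y(2) L(1) L(1) L(2)]
    by (simp add: ac_simps)
  finally show "real_of_int p ^ 2 * \<bar>real_of_int \<beta>\<bar> \<le> 18 * (L1\<^sup>2 * L2)"
    by (simp add: power2_eq_square)
  have "real_of_int p ^ 2 * \<bar>real_of_int \<gamma>\<bar> = \<bar>real_of_int (p\<^sup>2 * \<gamma>)\<bar>" by (simp add: abs_mult)
  also have "\<dots> = \<bar>3 * (n1 * n2 * n2) - 4 * (B * (n1 * z2 * z2)) - 8 * (B * (n2 * z1 * z2))
      + 3 * (A * (z1 * z2 * z2))\<bar>"
    unfolding co by (simp add: defs power2_eq_square power3_eq_cube algebra_simps)
  also have "\<dots> \<le> 18 * (L1 * L2 * L2)"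
    using mm[OF m(1) m(2) m(2) L(1) L(2) L(2)] bm[OF m(1) y(2) y(2) L(1) L(2) L(2)]
      bm[OF m(2) y(1) y(2) L(2) L(1) L(2)] am[OF y(1) y(2) y(2) L(1) L(2) L(2)]
    by (simp add: ac_simps)
  finally show "real_of_int p ^ 2 * \<bar>real_of_int \<gamma>\<bar> \<le> 18 * (L1 * L2\<^sup>2)"
    by (simp add: power2_eq_square)
qed

text \<open>The pairs for which the lengths \<open>L1 \<le> L2\<close> of the reduced basis and \<open>p\<close> satisfy
  \<open>l \<le> L1 \<le> 2 l\<close> and \<open>P \<le> p \<le> 2 P\<close>. In the application \<open>W\<close> is \<open>X\<^sup>2\<close>, rounded up.\<close>

definition cell :: "real \<Rightarrow> real \<Rightarrow> real \<Rightarrow> (int \<times> int) set" where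
  "cell W l P = {(a, b). real_of_int (a\<^sup>2) \<le> W ^ 3 \<and> real_of_int \<bar>b\<bar> \<le> W\<^sup>2 \<and>
     (\<exists>p m1 y1 m2 y2 \<alpha> \<beta> \<gamma> \<delta> L1 L2. cubic_data a b p m1 y1 m2 y2 (\<alpha>, \<beta>, \<gamma>, \<delta>) \<and> \<alpha> \<noteq> 0 \<and> y1 \<noteq> 0 \<and>
       P \<le> real_of_int p \<and> real_of_int p \<le> 2 * P \<and> l \<le> L1 \<and> L1 \<le> 2 * l \<and> L1 \<le> L2 \<and>
       L1 * L2 \<le> 2 * real_of_int p * W \<and>
       L1\<^sup>2 = real_of_int m1 ^ 2 + W\<^sup>2 * real_of_int y1 ^ 2 \<and>
       L2\<^sup>2 = real_of_int m2 ^ 2 + W\<^sup>2 * real_of_int y2 ^ 2)}"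

text \<open>By \<open>cubic_data_inj\<close> a pair is determined by the four coefficients,
  \<open>y1\<close>, \<open>y2\<close> and the sign of \<open>a\<close>. The product of the six
  ranges involves \<open>l\<close> and the bound \<open>M\<close> for L2 only through l M = 4 P W,
  so \<open>l\<close> disappears from the result.\<close>

lemma card_cell_le:
  fixes W l P :: real
  assumes W: "W > 0" and l: "l > 0" and P: "P > 0"
  shows "real (card (cell W l P)) \<le> 3 ^ 6 * 72 ^ 4 * 4 ^ 8 * W ^ 5 / P"
proof (cases "cell W l P = {}")
  case True
  then show ?thesis using W P by simp
next
  case False
  \<comment> \<open>Upper bound for L2, since L1 is at least l and L1 L2 is at most 2 p W with p at
    most 2 P.\<close>
  define M where "M = 4 * P * W / l"
  have M: "M > 0" using assms by (simp add: M_def)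
  \<comment> \<open>With L1 at most 2 l and L2 at most M, the four coefficient bounds acquire the
    constants 48, 72, 36 and 6; 72 serves for all.\<close>
  define R1 R2 R3 R4 S1 S2 where "R1 = 72 * (l * l * l) / P\<^sup>2" and "R2 = 72 * (l * l * M) / P\<^sup>2"
    and "R3 = 72 * (l * M * M) / P\<^sup>2" and "R4 = 72 * (M * M * M) / P\<^sup>2"
    and "S1 = 2 * l / W" and "S2 = M / W"
  note Rdefs = R1_def R2_def R3_def R4_def S1_def S2_def
  define I where "I R = {x::int. \<bar>of_int x\<bar> \<le> R}" for R :: real
  have bounds: "\<alpha> \<in> I R1 \<and> \<beta> \<in> I R2 \<and> \<gamma> \<in> I R3 \<and> \<delta> \<in> I R4 \<and> y1 \<in> I S1 \<and> y2 \<in> I S2 \<and>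
      L2 \<le> M \<and> W * \<bar>real_of_int y1\<bar> \<le> L1"
    if c: "cubic_data a b p m1 y1 m2 y2 (\<alpha>, \<beta>, \<gamma>, \<delta>)" and
      h: "real_of_int (a\<^sup>2) \<le> W ^ 3" "real_of_int \<bar>b\<bar> \<le> W\<^sup>2"
      "P \<le> real_of_int p" "real_of_int p \<le> 2 * P" "l \<le> L1" "L1 \<le> 2 * l" "L1 \<le> L2"
      "L1 * L2 \<le> 2 * real_of_int p * W"
      "L1\<^sup>2 = real_of_int m1 ^ 2 + W\<^sup>2 * real_of_int y1 ^ 2"
      "L2\<^sup>2 = real_of_int m2 ^ 2 + W\<^sup>2 * real_of_int y2 ^ 2"
    for a b p m1 y1 m2 y2 \<alpha> \<beta> \<gamma> \<delta> L1 L2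
  proof -
    have L0: "L1 \<ge> 0" "L2 \<ge> 0" using h l by auto
    note B = cubic_data_bounds[OF c h(1,2) W L0 h(9,10)]
    have "l * L2 \<le> L1 * L2" using h L0 by (intro mult_right_mono) auto
    also have "\<dots> \<le> 2 * real_of_int p * W" by (rule h)
    also have "\<dots> \<le> 2 * (2 * P) * W" using h W by (intro mult_right_mono mult_left_mono) auto
    finally have L2: "L2 \<le> M" using l by (simp add: M_def field_simps)
    have mem: "x \<in> I (72 * T / P\<^sup>2)"
      if "real_of_int p ^ 2 * \<bar>real_of_int x\<bar> \<le> 72 * T" for x T
    proof -
      have "P\<^sup>2 * \<bar>real_of_int x\<bar> \<le> real_of_int p ^ 2 * \<bar>real_of_int x\<bar>"
        using h P by (intro mult_right_mono power_mono) auto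
      then have "\<bar>real_of_int x\<bar> * P\<^sup>2 \<le> 72 * T" using that by (simp add: mult.commute)
      then show ?thesis using P by (simp add: I_def pos_le_divide_eq)
    qed
    have "L1 * L1 * L1 \<le> (2 * l) * (2 * l) * (2 * l)" using h L0 l by (intro mult_mono) auto
    then have t1: "L1 ^ 3 \<le> 8 * (l * l * l)" by (simp add: power3_eq_cube)
    have "L1 * L1 * L2 \<le> (2 * l) * (2 * l) * M" using h L0 l L2 by (intro mult_mono) auto
    then have t2: "L1\<^sup>2 * L2 \<le> 4 * (l * l * M)" by (simp add: power2_eq_square)
    have "L1 * L2 * L2 \<le> (2 * l) * M * M" using h L0 l L2 M by (intro mult_mono) auto
    then have t3: "L1 * L2\<^sup>2 \<le> 2 * (l * M * M)" by (simp add: power2_eq_square)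
    have "L2 * L2 * L2 \<le> M * M * M" using L0 L2 M by (intro mult_mono) auto
    then have t4: "L2 ^ 3 \<le> M * M * M" by (simp add: power3_eq_cube)
    have nn: "l * l * l \<ge> 0" "l * l * M \<ge> 0" "l * M * M \<ge> 0" "M * M * M \<ge> 0" using l M by simp_all
    have "\<alpha> \<in> I R1" unfolding R1_def by (rule mem) (use B(3) t1 nn in linarith)
    moreover have "\<beta> \<in> I R2" unfolding R2_def by (rule mem) (use B(4) t2 nn in linarith)
    moreover have "\<gamma> \<in> I R3" unfolding R3_def by (rule mem) (use B(5) t3 nn in linarith)
    moreover have "\<delta> \<in> I R4" unfolding R4_def by (rule mem) (use B(6) t4 nn in linarith)
    moreover have "y1 \<in> I S1" "y2 \<in> I S2"
      using B(1,2) h L2 W by (auto simp: I_def S1_def S2_def pos_le_divide_eq mult.commute)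
    ultimately show ?thesis using L2 B(1) by blast
  qed
  \<comment> \<open>In a nonempty cell \<open>\<alpha> \<noteq> 0\<close> and
    \<open>y1 \<noteq> 0\<close>, so \<open>R1\<close> and \<open>S1\<close> are at least 1. The
    other ranges follow from l \<le> M and W \<le> M.\<close>
  have ge1: "R1 \<ge> 1" "R2 \<ge> 1" "R3 \<ge> 1" "R4 \<ge> 1" "S1 \<ge> 1" "S2 \<ge> 1"
  proof -
    from False obtain x where "x \<in> cell W l P" by blast
    then obtain a b p m1 y1 m2 y2 \<alpha> \<beta> \<gamma> \<delta> L1 L2
      where c: "cubic_data a b p m1 y1 m2 y2 (\<alpha>, \<beta>, \<gamma>, \<delta>)" and
      h: "real_of_int (a\<^sup>2) \<le> W ^ 3" "real_of_int \<bar>b\<bar> \<le> W\<^sup>2"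
      "P \<le> real_of_int p" "real_of_int p \<le> 2 * P" "l \<le> L1" "L1 \<le> 2 * l" "L1 \<le> L2"
      "L1 * L2 \<le> 2 * real_of_int p * W"
      "L1\<^sup>2 = real_of_int m1 ^ 2 + W\<^sup>2 * real_of_int y1 ^ 2"
      "L2\<^sup>2 = real_of_int m2 ^ 2 + W\<^sup>2 * real_of_int y2 ^ 2" and nz: "\<alpha> \<noteq> 0" "y1 \<noteq> 0"
      unfolding cell_def by blast
    note B = bounds[OF c h]
    have "1 \<le> \<bar>real_of_int \<alpha>\<bar>" "1 \<le> \<bar>real_of_int y1\<bar>" using nz by linarith+
    then show R1: "R1 \<ge> 1" and "S1 \<ge> 1" using B by (auto simp: I_def)
    have lM: "l \<le> M" using B h by linarith
    have "W * 1 \<le> W * \<bar>real_of_int y1\<bar>" using \<open>1 \<le> \<bar>real_of_int y1\<bar>\<close> W by (intro mult_left_mono) auto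
    then have "W \<le> M" using B h by linarith
    then show "S2 \<ge> 1" using W by (simp add: S2_def)
    have "R1 \<le> R2" "R2 \<le> R3" "R3 \<le> R4"
      unfolding Rdefs using l M lM P
      by (intro divide_right_mono mult_left_mono mult_mono; simp)+
    then show "R2 \<ge> 1" "R3 \<ge> 1" "R4 \<ge> 1" using R1 by linarith+
  qed
  note fin = ge1[THEN card_int_abs_le(1), folded I_def] and cI = ge1[THEN card_int_abs_le(2), folded I_def]
  \<comment> \<open>The Boolean records whether \<open>a > 0\<close>, which recovers
    \<open>a\<close> from its square.\<close>
  let ?T = "(I R1 \<times> I R2 \<times> I R3 \<times> I R4) \<times> (I S1 \<times> I S2) \<times> (UNIV :: bool set)"
  let ?r = "\<lambda>(a, b) (F, (y1, y2), s). \<exists>p m1 m2. p \<noteq> 0 \<and> cubic_data a b p m1 y1 m2 y2 F \<and> s = (a > 0)"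
  have "card (cell W l P) \<le> card ?T"
  proof (rule card_le_if_inj_on_rel[where r = ?r])
    show "finite ?T" using fin by auto
  next
    fix x assume "x \<in> cell W l P"
    then obtain a b p m1 y1 m2 y2 \<alpha> \<beta> \<gamma> \<delta> L1 L2
      where x: "x = (a, b)" and c: "cubic_data a b p m1 y1 m2 y2 (\<alpha>, \<beta>, \<gamma>, \<delta>)" and
      h: "real_of_int (a\<^sup>2) \<le> W ^ 3" "real_of_int \<bar>b\<bar> \<le> W\<^sup>2"
      "P \<le> real_of_int p" "real_of_int p \<le> 2 * P" "l \<le> L1" "L1 \<le> 2 * l" "L1 \<le> L2"
      "L1 * L2 \<le> 2 * real_of_int p * W"
      "L1\<^sup>2 = real_of_int m1 ^ 2 + W\<^sup>2 * real_of_int y1 ^ 2"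
      "L2\<^sup>2 = real_of_int m2 ^ 2 + W\<^sup>2 * real_of_int y2 ^ 2"
      unfolding cell_def by blast
    have "p \<noteq> 0" using h P by auto
    then show "\<exists>t. t \<in> ?T \<and> ?r x t"
      using bounds[OF c h] c x
      by (intro exI[of _ "((\<alpha>, \<beta>, \<gamma>, \<delta>), (y1, y2), a > 0)"]) auto
  next
    fix x x' t assume "?r x t" "?r x' t"
    then obtain a b a' b' F y1 y2 s p m1 m2 p' m1' m2' where x: "x = (a, b)" "x' = (a', b')"
      and c: "cubic_data a b p m1 y1 m2 y2 F" "cubic_data a' b' p' m1' y1 m2' y2 F"
      and p: "p \<noteq> 0" "p' \<noteq> 0" and s: "(a > 0) = (a' > 0)"
      by (cases x; cases x'; cases t) auto
    have "a\<^sup>2 = a'\<^sup>2" "b = b'" using cubic_data_inj[OF c p] by auto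
    moreover from this s have "a = a'" by (auto simp: power2_eq_iff)
    ultimately show "x = x'" using x by simp
  qed
  also have "card ?T = (card (I R1) * (card (I R2) * (card (I R3) * card (I R4)))) *
      ((card (I S1) * card (I S2)) * 2)"
    by (simp add: card_cartesian_product)
  finally have "real (card (cell W l P)) \<le>
      (real (card (I R1)) * (real (card (I R2)) * (real (card (I R3)) * real (card (I R4))))) *
      ((real (card (I S1)) * real (card (I S2))) * 2)"
    by (metis of_nat_le_iff of_nat_mult of_nat_numeral)
  also have "\<dots> \<le> ((3 * R1) * ((3 * R2) * ((3 * R3) * (3 * R4)))) * (((3 * S1) * (3 * S2)) * 2)"
    using cI ge1 by (intro mult_mono mult_nonneg_nonneg) auto
  also have "\<dots> = 3 ^ 6 * 72 ^ 4 * 4 * (l * M) ^ 7 / (P ^ 8 * W\<^sup>2)"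
    unfolding Rdefs using W P by (simp add: field_simps power_numeral_reduce)
  also have "l * M = 4 * P * W" using l by (simp add: M_def)
  also have "3 ^ 6 * 72 ^ 4 * 4 * (4 * P * W) ^ 7 / (P ^ 8 * W\<^sup>2) = 3 ^ 6 * 72 ^ 4 * 4 ^ 8 * W ^ 5 / P"
    using W P by (simp add: field_simps power_numeral_reduce)
  finally show ?thesis .
qed

lemma finite_cell: "finite (cell W l P)"
proof (rule finite_subset)
  show "cell W l P \<subseteq> {x::int. \<bar>of_int x\<bar> \<le> max 1 (W ^ 3)} \<times> {x::int. \<bar>of_int x\<bar> \<le> max 1 (W\<^sup>2)}"
  proof
    fix x assume "x \<in> cell W l P"
    then obtain a b where x: "x = (a, b)" "real_of_int (a\<^sup>2) \<le> W ^ 3" "real_of_int \<bar>b\<bar> \<le> W\<^sup>2"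
      by (auto simp: cell_def)
    have "\<bar>a\<bar> \<le> a\<^sup>2"
      using mult_left_mono[of 1 "\<bar>a\<bar>" "\<bar>a\<bar>"] by (cases "a = 0") (auto simp: power2_eq_square)
    then have "\<bar>real_of_int a\<bar> \<le> real_of_int (a\<^sup>2)" by linarith
    then show "x \<in> {x::int. \<bar>of_int x\<bar> \<le> max 1 (W ^ 3)} \<times> {x::int. \<bar>of_int x\<bar> \<le> max 1 (W\<^sup>2)}"
      using x by (auto simp: le_max_iff_disj)
  qed
qed (intro finite_cartesian_product card_int_abs_le, auto)

section \<open>Dyadic ranges and resolvents with an integer root\<close>

lemma ex_power_interval:
  fixes x :: real
  assumes "x \<ge> 1"
  shows "\<exists>n. 2 ^ n \<le> x \<and> x < 2 ^ Suc n"
proof -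
  obtain m where "x < 2 ^ m" using real_arch_pow[of 2 x] by auto
  define k where "k = (LEAST m. x < 2 ^ m)"
  have k: "x < 2 ^ k" unfolding k_def by (rule LeastI) fact
  have "k \<noteq> 0" using k assms by (cases k) auto
  then obtain n where n: "k = Suc n" by (cases k) auto
  have "\<not> x < 2 ^ n" using not_less_Least[of n "\<lambda>m. x < 2 ^ m"] n unfolding k_def by simp
  then show ?thesis using k n by (intro exI[of _ n]) auto
qed

text \<open>When the leading coefficient of the form vanishes, m / y is a rational root of the monic
  resolvent, hence an integer. The argument is the rational root theorem in homogeneous
  form.\<close>

lemma monic_cubic_integer_root:
  fixes m y a b :: int
  assumes "m ^ 3 - 4 * b * m * y\<^sup>2 + a\<^sup>2 * y ^ 3 = 0" and "y \<noteq> 0"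
  shows "\<exists>k. k ^ 3 - 4 * b * k + a\<^sup>2 = 0"
proof -
  define g where "g = gcd m y"
  have g: "g \<noteq> 0" using assms by (simp add: g_def)
  obtain m' y' where my: "m = m' * g" "y = y' * g" and cop: "coprime m' y'"
    using gcd_coprime_exists[of m y] g unfolding g_def by metis
  have "g ^ 3 * (m' ^ 3 - 4 * b * m' * y'\<^sup>2 + a\<^sup>2 * y' ^ 3) = 0"
    using assms(1) unfolding my by (simp add: algebra_simps power_mult_distrib power2_eq_square power3_eq_cube)
  then have eq: "m' ^ 3 - 4 * b * m' * y'\<^sup>2 + a\<^sup>2 * y' ^ 3 = 0" using g by simp
  then have "m' ^ 3 = y' * (4 * b * m' * y' - a\<^sup>2 * y'\<^sup>2)"
    by (simp add: algebra_simps power2_eq_square power3_eq_cube)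
  then have "y' dvd m' ^ 3" by simp
  moreover have "coprime y' (m' ^ 3)" using cop by (simp add: coprime_commute)
  ultimately have "is_unit y'" by (metis coprime_absorb_left)
  then have "y' = 1 \<or> y' = -1" by auto
  then show ?thesis
  proof
    assume "y' = 1"
    then show ?thesis using eq by (intro exI[of _ m']) simp
  next
    assume "y' = -1"
    then show ?thesis using eq by (intro exI[of _ "- m'"]) simp
  qed
qed

text \<open>Beyond 3 W the cube is at least 9 W^2 |k|, which outweighs 4 W^2 |k| + W^3.\<close>

lemma monic_cubic_root_bound:
  fixes k :: int and W :: real
  assumes k: "k ^ 3 - 4 * b * k + a\<^sup>2 = 0" and W: "W > 0"
    and a: "real_of_int (a\<^sup>2) \<le> W ^ 3" and b: "real_of_int \<bar>b\<bar> \<le> W\<^sup>2"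
  shows "\<bar>real_of_int k\<bar> \<le> 3 * W"
proof (rule ccontr)
  assume "\<not> \<bar>real_of_int k\<bar> \<le> 3 * W"
  define x where "x = \<bar>real_of_int k\<bar>"
  have x: "x > 3 * W" using \<open>\<not> _\<close> by (simp add: x_def)
  have "k ^ 3 = 4 * b * k - a\<^sup>2" using k by simp
  then have "real_of_int (k ^ 3) = real_of_int (4 * b * k - a\<^sup>2)" by (rule arg_cong)
  then have "real_of_int k ^ 3 = 4 * real_of_int b * real_of_int k - real_of_int (a\<^sup>2)" by simp
  then have "x ^ 3 = \<bar>4 * real_of_int b * real_of_int k - real_of_int (a\<^sup>2)\<bar>"
    by (simp add: x_def power_abs[symmetric])
  also have "\<dots> \<le> \<bar>4 * real_of_int b * real_of_int k\<bar> + real_of_int (a\<^sup>2)"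
    using abs_triangle_ineq4[of "4 * real_of_int b * real_of_int k" "real_of_int (a\<^sup>2)"] by simp
  also have "\<bar>4 * real_of_int b * real_of_int k\<bar> = 4 * (real_of_int \<bar>b\<bar> * x)"
    by (simp add: x_def abs_mult)
  also have "real_of_int \<bar>b\<bar> * x \<le> W\<^sup>2 * x"
    using b by (intro mult_right_mono) (auto simp: x_def)
  finally have 1: "x ^ 3 \<le> 4 * (W\<^sup>2 * x) + W ^ 3" using a by linarith
  have "(3 * W) * (3 * W) * x \<le> x * x * x"
    using x W by (intro mult_mono) auto
  then have "9 * (W\<^sup>2 * x) \<le> x ^ 3" by (simp add: power2_eq_square power3_eq_cube)
  moreover have "W\<^sup>2 * (3 * W) < W\<^sup>2 * x" using x W by (intro mult_strict_left_mono) auto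
  then have "3 * W ^ 3 < W\<^sup>2 * x" by (simp add: power2_eq_square power3_eq_cube)
  moreover have "W ^ 3 > 0" using W by simp
  ultimately show False using 1 by linarith
qed

definition cubic_root_pairs :: "real \<Rightarrow> (int \<times> int) set" where
  "cubic_root_pairs W = {(a, b). a \<noteq> 0 \<and> real_of_int (a\<^sup>2) \<le> W ^ 3 \<and> real_of_int \<bar>b\<bar> \<le> W\<^sup>2 \<and>
     (\<exists>k. k ^ 3 - 4 * b * k + a\<^sup>2 = 0)}"

lemma abs_le_of_sq_le:
  fixes a :: int and W :: real
  assumes "real_of_int (a\<^sup>2) \<le> W ^ 3" and W: "W \<ge> 1"
  shows "\<bar>real_of_int a\<bar> \<le> W\<^sup>2"
proof (rule power2_le_imp_le)
  have "\<bar>real_of_int a\<bar>\<^sup>2 \<le> W ^ 3" using assms by simp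
  also have "\<dots> \<le> W ^ 4" using W by (intro power_increasing) auto
  finally show "\<bar>real_of_int a\<bar>\<^sup>2 \<le> (W\<^sup>2)\<^sup>2" by simp
qed simp

text \<open>\<open>a\<close> and the root \<open>k\<close> determine \<open>b\<close>, because
  \<open>a \<noteq> 0\<close> excludes \<open>k = 0\<close>. Even the crude bound W^2 for |a|
  suffices: for W of order X^2 the count is O(X^6), against about X^7 pairs in the box.\<close>

lemma card_cubic_root_pairs_le:
  assumes W: "W \<ge> 1"
  shows "finite (cubic_root_pairs W)" and "real (card (cubic_root_pairs W)) \<le> 27 * W ^ 3"
proof -
  let ?T = "{x::int. \<bar>of_int x\<bar> \<le> W\<^sup>2} \<times> {x::int. \<bar>of_int x\<bar> \<le> 3 * W}"
  have ge1: "W\<^sup>2 \<ge> 1" "3 * W \<ge> 1" using W by (auto simp: one_le_power)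
  note c = ge1[THEN card_int_abs_le(1)] ge1[THEN card_int_abs_le(2)]
  have "cubic_root_pairs W \<subseteq> {x::int. \<bar>of_int x\<bar> \<le> W\<^sup>2} \<times> {x::int. \<bar>of_int x\<bar> \<le> W\<^sup>2}"
    using abs_le_of_sq_le[OF _ W] by (auto simp: cubic_root_pairs_def)
  then show "finite (cubic_root_pairs W)"
    by (rule finite_subset) (use c in blast)
  have "card (cubic_root_pairs W) \<le> card ?T"
  proof (rule card_le_if_inj_on_rel[where
        r = "\<lambda>(a, b) (a', k::int). a \<noteq> 0 \<and> a' = a \<and> k ^ 3 - 4 * b * k + a\<^sup>2 = 0"])
    show "finite ?T" using c by blast
  next
    fix x assume "x \<in> cubic_root_pairs W"
    then obtain a b k where x: "x = (a, b)" "a \<noteq> 0" "real_of_int (a\<^sup>2) \<le> W ^ 3"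
      "real_of_int \<bar>b\<bar> \<le> W\<^sup>2" "k ^ 3 - 4 * b * k + a\<^sup>2 = 0"
      by (auto simp: cubic_root_pairs_def)
    then have "(a, k) \<in> ?T"
      using abs_le_of_sq_le[OF x(3) W] monic_cubic_root_bound[OF x(5) _ x(3,4)] W by auto
    then show "\<exists>t. t \<in> ?T \<and> (case x of (a, b) \<Rightarrow> \<lambda>(a', k::int). a \<noteq> 0 \<and> a' = a \<and> k ^ 3 - 4 * b * k + a\<^sup>2 = 0) t"
      using x by (intro exI[of _ "(a, k)"]) auto
  next
    fix x x' t
    assume "(case x of (a, b) \<Rightarrow> \<lambda>(a', k::int). a \<noteq> 0 \<and> a' = a \<and> k ^ 3 - 4 * b * k + a\<^sup>2 = 0) t"
      and "(case x' of (a, b) \<Rightarrow> \<lambda>(a', k::int). a \<noteq> 0 \<and> a' = a \<and> k ^ 3 - 4 * b * k + a\<^sup>2 = 0) t"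
    then obtain a b b' k where x: "x = (a, b)" "x' = (a, b')" "a \<noteq> 0"
      "k ^ 3 - 4 * b * k + a\<^sup>2 = 0" "k ^ 3 - 4 * b' * k + a\<^sup>2 = 0"
      by (cases x; cases x'; cases t) auto
    have "k \<noteq> 0" using x by auto
    moreover have "4 * b * k = 4 * b' * k" using x by linarith
    ultimately show "x = x'" using x by simp
  qed
  also have "card ?T = card {x::int. \<bar>of_int x\<bar> \<le> W\<^sup>2} * card {x::int. \<bar>of_int x\<bar> \<le> 3 * W}"
    by (rule card_cartesian_product)
  finally have "real (card (cubic_root_pairs W)) \<le>
      real (card {x::int. \<bar>of_int x\<bar> \<le> W\<^sup>2}) * real (card {x::int. \<bar>of_int x\<bar> \<le> 3 * W})"
    by (simp flip: of_nat_mult)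
  also have "\<dots> \<le> (3 * W\<^sup>2) * (3 * (3 * W))" using c ge1 by (intro mult_mono) auto
  finally show "real (card (cubic_root_pairs W)) \<le> 27 * W ^ 3"
    by (simp add: power2_eq_square power3_eq_cube)
qed

section \<open>Covering the large primes by dyadic cells\<close>

definition large_prime_pairs :: "real \<Rightarrow> real \<Rightarrow> (int \<times> int) set" where
  "large_prime_pairs W Y = {(a, b). a \<noteq> 0 \<and> real_of_int (a\<^sup>2) \<le> W ^ 3 \<and> real_of_int \<bar>b\<bar> \<le> W\<^sup>2 \<and>
     qdisc a b \<noteq> 0 \<and> (\<exists>p. prime p \<and> real p > Y \<and> \<not> int p dvd a \<and> (int p)\<^sup>2 dvd qdisc a b)}"

text \<open>A form with \<open>\<alpha> = 0\<close> yields an integer root of the resolvent.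
  Otherwise the shorter length L1 and \<open>p\<close> lie between 1 and 17 w^3, hence in dyadic
  intervals with exponents below \<open>K\<close>.\<close>

lemma large_prime_pairs_subset:
  fixes w K :: nat and Y :: real
  assumes w: "w > 0" and Y: "Y \<ge> 2 * real w" "Y \<ge> 5" and K: "2 ^ K > 17 * real w ^ 3"
  shows "large_prime_pairs w Y \<subseteq> cubic_root_pairs w \<union>
    (\<Union>(i, j)\<in>{..<K} \<times> {j. j < K \<and> Y < 2 ^ Suc j}. cell w (2 ^ i) (2 ^ j))"
proof
  define W where "W = real w"
  have W: "W \<ge> 1" using w by (simp add: W_def)
  fix x assume "x \<in> large_prime_pairs w Y"
  then obtain a b p where x: "x = (a, b)" "a \<noteq> 0" "real_of_int (a\<^sup>2) \<le> W ^ 3" "real_of_int \<bar>b\<bar> \<le> W\<^sup>2"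
    "qdisc a b \<noteq> 0" "prime p" "real p > Y" "\<not> int p dvd a" "(int p)\<^sup>2 dvd qdisc a b"
    by (auto simp: large_prime_pairs_def W_def)
  have p5: "p \<ge> 5" using x Y by linarith
  \<comment> \<open>p^2 is at most |D|, which is at most (256 + 27) W^6, and 283 is below
    17^2.\<close>
  have pW: "real p \<le> 17 * W ^ 3"
  proof (rule power2_le_imp_le)
    have "(int p)\<^sup>2 \<le> \<bar>qdisc a b\<bar>" using x(5,9) by (meson zdvd_imp_le dvd_abs_iff zero_less_abs_iff)
    then have "real_of_int ((int p)\<^sup>2) \<le> real_of_int \<bar>qdisc a b\<bar>" by (simp only: of_int_le_iff)
    also have "\<dots> \<le> 256 * real_of_int \<bar>b\<bar> ^ 3 + 27 * (real_of_int (a\<^sup>2))\<^sup>2"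
    proof -
      have "\<bar>qdisc a b\<bar> \<le> \<bar>256 * b ^ 3\<bar> + \<bar>27 * a ^ 4\<bar>" unfolding qdisc_def by (rule abs_triangle_ineq4)
      also have "\<dots> = 256 * \<bar>b\<bar> ^ 3 + 27 * (a\<^sup>2)\<^sup>2" by (simp add: abs_mult power_abs)
      finally have "real_of_int \<bar>qdisc a b\<bar> \<le> real_of_int (256 * \<bar>b\<bar> ^ 3 + 27 * (a\<^sup>2)\<^sup>2)"
        by (simp only: of_int_le_iff)
      then show ?thesis by simp
    qed
    also have "\<dots> \<le> 256 * (W\<^sup>2) ^ 3 + 27 * (W ^ 3)\<^sup>2"
      using x(3,4) by (intro add_mono mult_left_mono power_mono) auto
    also have "\<dots> \<le> (17 * W ^ 3)\<^sup>2" by (simp add: power_mult_distrib flip: power_mult)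
    finally show "(real p)\<^sup>2 \<le> (17 * W ^ 3)\<^sup>2" by simp
  qed (use W in simp)
  have ip: "prime (int p)" "int p \<ge> 5" "int w > 0" using x p5 w by auto
  obtain m1 y1 m2 y2 F where c: "cubic_data a b (int p) m1 y1 m2 y2 F"
    and y10: "y1 = 0 \<longrightarrow> (int p)\<^sup>2 \<le> m1\<^sup>2"
    and q: "m1\<^sup>2 + (int w)\<^sup>2 * y1\<^sup>2 \<le> m2\<^sup>2 + (int w)\<^sup>2 * y2\<^sup>2"
    "3 * ((m1\<^sup>2 + (int w)\<^sup>2 * y1\<^sup>2) * (m2\<^sup>2 + (int w)\<^sup>2 * y2\<^sup>2)) \<le> 4 * (int p * int w)\<^sup>2"
    using cubic_data_exists[OF ip(1,2) x(9,8) ip(3)] by blast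
  obtain \<alpha> \<beta> \<gamma> \<delta> where F: "F = (\<alpha>, \<beta>, \<gamma>, \<delta>)" by (cases F) auto
  define q1 q2 where "q1 = real_of_int m1 ^ 2 + W\<^sup>2 * real_of_int y1 ^ 2"
    and "q2 = real_of_int m2 ^ 2 + W\<^sup>2 * real_of_int y2 ^ 2"
  have q1: "q1 = real_of_int (m1\<^sup>2 + (int w)\<^sup>2 * y1\<^sup>2)" and q2: "q2 = real_of_int (m2\<^sup>2 + (int w)\<^sup>2 * y2\<^sup>2)"
    by (simp_all add: q1_def q2_def W_def)
  have q0: "q1 \<ge> 0" "q2 \<ge> 0" by (simp_all add: q1_def q2_def)
  have q12: "q1 \<le> q2" unfolding q1 q2 using q(1) by (simp only: of_int_le_iff)
  have "real_of_int (3 * ((m1\<^sup>2 + (int w)\<^sup>2 * y1\<^sup>2) * (m2\<^sup>2 + (int w)\<^sup>2 * y2\<^sup>2))) \<le> real_of_int (4 * (int p * int w)\<^sup>2)"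
    using q(2) by (simp only: of_int_le_iff)
  then have qq: "3 * (q1 * q2) \<le> 4 * (real p * W)\<^sup>2" unfolding q1 q2 by (simp add: W_def)
  define L1 L2 where "L1 = sqrt q1" and "L2 = sqrt q2"
  have L: "L1\<^sup>2 = q1" "L2\<^sup>2 = q2" "L1 \<ge> 0" "L2 \<ge> 0" "L1 \<le> L2"
    using q0 q12 by (auto simp: L1_def L2_def)
  have LL: "L1 * L2 \<le> 2 * real p * W"
  proof (rule power2_le_imp_le)
    have "(L1 * L2)\<^sup>2 = q1 * q2" using L by (simp add: power_mult_distrib)
    also have "\<dots> \<le> 4 * (real p * W)\<^sup>2" using qq q0 mult_nonneg_nonneg[OF q0] by linarith
    finally show "(L1 * L2)\<^sup>2 \<le> (2 * real p * W)\<^sup>2" by (simp add: power_mult_distrib)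
  qed (use W in simp)
  have L1sq: "L1\<^sup>2 \<le> 2 * real p * W"
    using LL mult_left_mono[OF L(5) L(3)] by (simp add: power2_eq_square)
  \<comment> \<open>Otherwise p^2 \<le> m1^2 = L1^2 \<le> L1 L2 \<le> 2 p W, contrary to p > Y \<ge>
    2 W.\<close>
  have y1: "y1 \<noteq> 0"
  proof
    assume y0: "y1 = 0"
    then have "real_of_int ((int p)\<^sup>2) \<le> real_of_int (m1\<^sup>2)" using y10 by (simp only: of_int_le_iff)
    then have "(real p)\<^sup>2 \<le> 2 * real p * W" using L1sq L(1) y0 by (simp add: q1_def)
    then have "real p * real p \<le> real p * (2 * W)" by (simp add: power2_eq_square)
    then have "real p \<le> 2 * W" using p5 by simp
    then show False using x(7) Y(1) by (simp add: W_def)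
  qed
  show "x \<in> cubic_root_pairs w \<union>
    (\<Union>(i, j)\<in>{..<K} \<times> {j. j < K \<and> Y < 2 ^ Suc j}. cell w (2 ^ i) (2 ^ j))"
  proof (cases "\<alpha> = 0")
    case True
    then have "m1 ^ 3 - 4 * b * m1 * y1\<^sup>2 + a\<^sup>2 * y1 ^ 3 = 0"
      using c by (simp add: cubic_data_def F)
    then have "\<exists>k. k ^ 3 - 4 * b * k + a\<^sup>2 = 0" using monic_cubic_integer_root y1 by blast
    then show ?thesis using x by (auto simp: cubic_root_pairs_def W_def)
  next
    case False
    \<comment> \<open>A nonzero \<open>y1\<close> makes L1 at least W, hence at least 1, so that the
      dyadic exponent of L1 is a natural number.\<close>
    have "1 \<le> \<bar>real_of_int y1\<bar>" using y1 by linarith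
    then have "1 \<le> \<bar>real_of_int y1\<bar> ^ 2" by (rule one_le_power)
    moreover have "1 \<le> W\<^sup>2" using W by (rule one_le_power)
    ultimately have "1 * 1 \<le> W\<^sup>2 * real_of_int y1 ^ 2" by (intro mult_mono) auto
    then have "1\<^sup>2 \<le> L1\<^sup>2" unfolding L(1) q1_def by (simp add: add_increasing)
    then have L11: "L1 \<ge> 1" using L(3) power2_le_imp_le by blast
    obtain i where i: "2 ^ i \<le> L1" "L1 < 2 ^ Suc i" using ex_power_interval[OF L11] by blast
    obtain j where j: "2 ^ j \<le> real p" "real p < 2 ^ Suc j"
      using ex_power_interval[of "real p"] p5 by auto
    have "L1 \<le> 17 * W ^ 3"
    proof (rule power2_le_imp_le)
      have "L1\<^sup>2 \<le> 2 * (17 * W ^ 3) * W"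
        using L1sq pW W by (smt (verit) mult_right_mono)
      also have "\<dots> = 34 * W ^ 4" by (simp add: power_numeral_reduce)
      also have "\<dots> \<le> 34 * W ^ 6" using W by (intro mult_left_mono power_increasing) auto
      also have "\<dots> \<le> (17 * W ^ 3)\<^sup>2" by (simp add: power_mult_distrib flip: power_mult)
      finally show "L1\<^sup>2 \<le> (17 * W ^ 3)\<^sup>2" .
    qed (use W in simp)
    then have "(2::real) ^ i < 2 ^ K" using i(1) K unfolding W_def by linarith
    then have iK: "i < K" by simp
    have "(2::real) ^ j < 2 ^ K" using j(1) pW K unfolding W_def by linarith
    then have jK: "j < K" by simp
    have "Y < 2 ^ Suc j" using x(7) j by linarith
    moreover have "cubic_data a b (int p) m1 y1 m2 y2 (\<alpha>, \<beta>, \<gamma>, \<delta>) \<and> \<alpha> \<noteq> 0 \<and> y1 \<noteq> 0 \<and>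
       2 ^ j \<le> real_of_int (int p) \<and> real_of_int (int p) \<le> 2 * 2 ^ j \<and>
       2 ^ i \<le> L1 \<and> L1 \<le> 2 * 2 ^ i \<and> L1 \<le> L2 \<and>
       L1 * L2 \<le> 2 * real_of_int (int p) * W \<and>
       L1\<^sup>2 = real_of_int m1 ^ 2 + W\<^sup>2 * real_of_int y1 ^ 2 \<and>
       L2\<^sup>2 = real_of_int m2 ^ 2 + W\<^sup>2 * real_of_int y2 ^ 2"
      using c[unfolded F] False y1 i j L LL by (simp add: q1_def q2_def)
    then have "x \<in> cell w (2 ^ i) (2 ^ j)"
      unfolding cell_def x(1) mem_Collect_eq prod.case W_def[symmetric] using x(3,4) by blast
    ultimately show ?thesis using iK jK by blast
  qed
qed

text \<open>There are at most K^2 cells, and 2^j > Y / 2 bounds each by O(w^5 / Y). For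
  \<open>K\<close> logarithmic in \<open>w\<close> this loses only a squared logarithm.\<close>

lemma card_large_prime_pairs_le:
  fixes w K :: nat and Y :: real
  assumes w: "w > 0" and Y: "Y \<ge> 2 * real w" "Y \<ge> 5" and K: "2 ^ K > 17 * real w ^ 3"
  shows "finite (large_prime_pairs w Y)"
    and "real (card (large_prime_pairs w Y)) \<le>
      27 * real w ^ 3 + (real K)\<^sup>2 * (2 * 3 ^ 6 * 72 ^ 4 * 4 ^ 8) * real w ^ 5 / Y"
proof -
  define C :: real where "C = 3 ^ 6 * 72 ^ 4 * 4 ^ 8"
  have C: "C > 0" by (simp add: C_def)
  let ?J = "{j. j < K \<and> Y < 2 ^ Suc j}"
  let ?I = "{..<K} \<times> ?J"
  let ?U = "\<Union>(i, j)\<in>?I. cell w (2 ^ i) (2 ^ j)"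
  have W: "real w \<ge> 1" using w by simp
  note sub = large_prime_pairs_subset[OF w Y K]
  have finI: "finite ?I" by simp
  have finU: "finite ?U" using finI finite_cell by auto
  have fin: "finite (cubic_root_pairs w \<union> ?U)" using finU card_cubic_root_pairs_le(1)[OF W] by blast
  then show "finite (large_prime_pairs w Y)" using sub finite_subset by blast
  have "real (card ?U) \<le> (\<Sum>x\<in>?I. real (card (case x of (i, j) \<Rightarrow> cell w (2 ^ i) (2 ^ j))))"
    by (rule real_card_UN_le[OF finI])
  also have "\<dots> \<le> (\<Sum>x\<in>?I. 2 * C * real w ^ 5 / Y)"
  proof (rule sum_mono)
    fix x assume "x \<in> ?I"
    then obtain i j where x: "x = (i, j)" "Y < 2 ^ Suc j" by auto
    have "real (card (cell w (2 ^ i) (2 ^ j))) \<le> C * real w ^ 5 / 2 ^ j"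
      unfolding C_def using W by (intro card_cell_le) auto
    also have "\<dots> \<le> C * real w ^ 5 / (Y / 2)"
      using x Y C by (intro divide_left_mono) auto
    finally show "real (card (case x of (i, j) \<Rightarrow> cell w (2 ^ i) (2 ^ j))) \<le> 2 * C * real w ^ 5 / Y"
      by (simp add: x mult.commute mult.left_commute)
  qed
  also have "\<dots> = real (card ?I) * (2 * C * real w ^ 5 / Y)" by simp
  also have "\<dots> \<le> (real K)\<^sup>2 * (2 * C * real w ^ 5 / Y)"
  proof (rule mult_right_mono)
    have "card ?J \<le> card {..<K}" by (rule card_mono) auto
    then have "K * card ?J \<le> K * K" by simp
    then have "card ?I \<le> K * K" by (simp add: card_cartesian_product)
    then show "real (card ?I) \<le> (real K)\<^sup>2" by (simp add: power2_eq_square flip: of_nat_mult)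
  qed (use C Y in auto)
  finally have U: "real (card ?U) \<le> (real K)\<^sup>2 * (2 * C * real w ^ 5 / Y)" .
  have "card (large_prime_pairs w Y) \<le> card (cubic_root_pairs w \<union> ?U)" by (rule card_mono[OF fin sub])
  also have "\<dots> \<le> card (cubic_root_pairs w) + card ?U" by (rule card_Un_le)
  finally have "real (card (large_prime_pairs w Y)) \<le> real (card (cubic_root_pairs w)) + real (card ?U)"
    by simp
  also have "\<dots> \<le> 27 * real w ^ 3 + (real K)\<^sup>2 * (2 * C * real w ^ 5 / Y)"
    using U card_cubic_root_pairs_le(2)[OF W] by linarith
  finally show "real (card (large_prime_pairs w Y)) \<le>
      27 * real w ^ 3 + (real K)\<^sup>2 * (2 * 3 ^ 6 * 72 ^ 4 * 4 ^ 8) * real w ^ 5 / Y"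
    by (simp add: C_def)
qed

section \<open>The Euler product\<close>

lemma euler_factor_bounds: "0 < euler_factor n" "euler_factor n \<le> 1" "1 - 2 / real n ^ 2 \<le> euler_factor n"
proof -
  have *: "0 < 1 - 2 / real n ^ 2 + 1 / real n ^ 3 \<and> 1 - 2 / real n ^ 2 + 1 / real n ^ 3 \<le> 1" if "n \<ge> 5"
  proof -
    have n: "real n \<ge> 5" using that by simp
    have "5 * 5 \<le> real n * real n" using n by (intro mult_mono) auto
    then have "2 / real n ^ 2 < 1" using n by (simp add: power2_eq_square divide_simps)
    moreover have "1 / real n ^ 3 \<le> 2 / real n ^ 2"
      using n by (simp add: field_simps power2_eq_square power3_eq_cube)
    moreover have "1 / real n ^ 3 > 0" using n by simp
    ultimately show ?thesis by linarith
  qed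
  then show "0 < euler_factor n" "euler_factor n \<le> 1" by (auto simp: euler_factor_def)
  show "1 - 2 / real n ^ 2 \<le> euler_factor n" by (auto simp: euler_factor_def)
qed

lemma convergent_prod_euler_factor: "convergent_prod euler_factor"
proof -
  have "summable (\<lambda>i. norm (euler_factor i - 1))"
  proof (rule summable_comparison_test')
    show "summable (\<lambda>n. 2 * (1 / real n ^ 2))"
      using inverse_power_summable[of 2, where 'a = real] by (intro summable_mult) (simp add: divide_inverse)
    show "norm (norm (euler_factor n - 1)) \<le> 2 * (1 / real n ^ 2)" if "n \<ge> 0" for n
      using euler_factor_bounds[of n] by simp
  qed
  then have "abs_convergent_prod euler_factor" by (rule summable_imp_abs_convergent_prod)
  then show ?thesis by (rule abs_convergent_prod_imp_convergent_prod)
qed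

section \<open>Partial products over blocks of six\<close>

lemma prod_euler_factor_LIMSEQ: "(\<lambda>n. \<Prod>i<n. euler_factor i) \<longlonglongrightarrow> prodinf euler_factor"
  using convergent_prod_LIMSEQ[OF convergent_prod_euler_factor]
  by (subst filterlim_sequentially_Suc[symmetric]) (simp add: lessThan_Suc_atMost)

text \<open>The cut at 6 k + 3 leaves in each further block of six indices just two that are prime
  to 6, namely 6 k + 5 and 6 k + 7.\<close>

definition euler_prod6 :: "nat \<Rightarrow> real" where
  "euler_prod6 k = (\<Prod>i<6 * k + 3. euler_factor i)"

lemma euler_prod6_LIMSEQ: "euler_prod6 \<longlonglongrightarrow> prodinf euler_factor"
  unfolding euler_prod6_def
  by (rule filterlim_compose[OF prod_euler_factor_LIMSEQ]) real_asymp

lemma not_prime_mult: "a > 1 \<Longrightarrow> b > 1 \<Longrightarrow> \<not> prime (a * b)" for a b :: nat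
  by (metis less_irrefl nat_mult_1_right prime_product)

lemma euler_prod6_Suc:
  "euler_prod6 (Suc k) = euler_prod6 k * (euler_factor (6 * k + 5) * euler_factor (6 * k + 7))"
proof -
  have 1: "euler_factor n = 1" if "\<not> prime n \<or> n < 5" for n using that by (auto simp: euler_factor_def)
  have 2: "euler_factor (a * b) = 1" if "a > 1" "b > 1" for a b
    using 1 not_prime_mult[OF that] by blast
  have "euler_factor (6 * k + 3) = 1"
    using 1[of 3] 2[of 3 "2 * k + 1"] by (cases "k = 0") (simp_all add: algebra_simps)
  moreover have "euler_factor (6 * k + 4) = 1"
    using 2[of 2 "3 * k + 2"] by (simp add: algebra_simps numeral_eq_Suc)
  moreover have "euler_factor (6 * k + 6) = 1"
    using 2[of 2 "3 * k + 3"] by (simp add: algebra_simps)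
  moreover have "euler_factor (6 * k + 8) = 1"
    using 2[of 2 "3 * k + 4"] by (simp add: algebra_simps)
  moreover have "6 * Suc k + 3 = Suc (Suc (Suc (Suc (Suc (Suc (6 * k + 3))))))" by simp
  ultimately show ?thesis
    unfolding euler_prod6_def by (simp add: eval_nat_numeral)
qed

lemma euler_prod6_pos: "euler_prod6 k > 0"
  unfolding euler_prod6_def using euler_factor_bounds by (intro prod_pos) auto

lemma euler_prod6_decreasing: "euler_prod6 (Suc k) \<le> euler_prod6 k"
proof -
  have "euler_factor (6 * k + 5) * euler_factor (6 * k + 7) \<le> 1 * 1"
    using euler_factor_bounds by (intro mult_mono) (auto intro: less_imp_le)
  then show ?thesis
    unfolding euler_prod6_Suc using euler_prod6_pos[of k] by (simp add: mult_left_le)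
qed

text \<open>Only the integers congruent to \<open>\<plusminus>1\<close> modulo \<open>6\<close> contribute, which improves the
  elementary tail bound \<open>2 / N\<close> by a factor of three.\<close>

lemma euler_prod6_tail:
  "euler_prod6 k * (1 - 2 / 3 * (1 / (6 * real k + 3) - 1 / (6 * real (k + m) + 3))) \<le> euler_prod6 (k + m)"
proof (induction m)
  case (Suc m)
  define n where "n = k + m"
  \<comment> \<open>The midpoint of 6 n + 5 and 6 n + 7. The term \<open>t\<close> below telescopes
    from x - 3 = 6 n + 3 to x + 3 = 6 (n + 1) + 3.\<close>
  define x where "x = 6 * real n + 6"
  have x: "x \<ge> 6" by (simp add: x_def)
  define s where "s = 2 / 3 * (1 / (6 * real k + 3) - 1 / (6 * real n + 3))"
  define t where "t = 2 / 3 * (1 / (x - 3) - 1 / (x + 3))"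
  have s0: "s \<ge> 0" unfolding s_def n_def by (simp add: divide_simps)
  \<comment> \<open>As t = 4 / (x^2 - 9), the claim amounts to (x^2 + 1) (x^2 - 9) \<le> (x^2 -
    1)^2.\<close>
  have "2 / (x - 1) ^ 2 + 2 / (x + 1) ^ 2 \<le> t"
  proof -
    have "t = 4 / ((x - 3) * (x + 3))" using x by (simp add: t_def field_simps)
    moreover have "2 / (x - 1) ^ 2 + 2 / (x + 1) ^ 2 = 4 * (x\<^sup>2 + 1) / (((x - 1) * (x + 1)) ^ 2)"
      using x by (simp add: divide_simps power_mult_distrib) (simp add: algebra_simps power2_eq_square)
    moreover have "4 * (x\<^sup>2 + 1) * ((x - 3) * (x + 3)) \<le> 4 * ((x - 1) * (x + 1)) ^ 2"
      using x by (simp add: algebra_simps power2_eq_square)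
    ultimately show ?thesis
      using x by (simp add: divide_le_eq pos_le_divide_eq mult_pos_pos)
  qed
  moreover have "euler_factor (6 * n + 5) * euler_factor (6 * n + 7) \<ge> 1 - 2 / (x - 1) ^ 2 - 2 / (x + 1) ^ 2"
  proof -
    have e: "euler_factor (6 * n + 5) \<ge> 1 - 2 / (x - 1) ^ 2" "euler_factor (6 * n + 7) \<ge> 1 - 2 / (x + 1) ^ 2"
      using euler_factor_bounds(3)[of "6 * n + 5"] euler_factor_bounds(3)[of "6 * n + 7"]
      by (simp_all add: x_def add.commute)
    have "(1 - euler_factor (6 * n + 5)) * (1 - euler_factor (6 * n + 7)) \<ge> 0"
      using euler_factor_bounds by simp
    then show ?thesis using e by (simp add: algebra_simps)
  qed
  ultimately have ef: "euler_factor (6 * n + 5) * euler_factor (6 * n + 7) \<ge> 1 - t" by linarith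
  have t0: "t \<ge> 0" using x by (simp add: t_def divide_simps)
  have eq: "1 / (6 * real k + 3) - 1 / (6 * real (k + Suc m) + 3) =
      (1 / (6 * real k + 3) - 1 / (6 * real n + 3)) + (1 / (x - 3) - 1 / (x + 3))"
    by (simp add: x_def n_def algebra_simps)
  have "euler_prod6 k * (1 - 2 / 3 * (1 / (6 * real k + 3) - 1 / (6 * real (k + Suc m) + 3)))
      = euler_prod6 k * (1 - s - t)"
    unfolding s_def t_def eq distrib_left[of "2 / 3"] by (simp only: diff_diff_eq)
  also have "\<dots> \<le> euler_prod6 k * ((1 - s) * (1 - t))"
    using euler_prod6_pos[of k] s0 t0 by (intro mult_left_mono) (auto simp: algebra_simps)
  also have "\<dots> = euler_prod6 k * (1 - s) * (1 - t)" by simp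
  also have "\<dots> \<le> euler_prod6 n * (euler_factor (6 * n + 5) * euler_factor (6 * n + 7))"
  proof -
    have "x * x \<ge> 6 * 6" using x by (intro mult_mono) auto
    then have "t \<le> 1" using x by (simp add: t_def divide_simps) (simp add: algebra_simps)
    then show ?thesis
      using Suc ef euler_prod6_pos[of n] unfolding s_def n_def
      by (intro mult_mono) (auto intro: less_imp_le)
  qed
  also have "\<dots> = euler_prod6 (k + Suc m)" by (simp add: euler_prod6_Suc n_def)
  finally show ?case .
qed simp

lemma prodinf_euler_factor_bounds:
  "prodinf euler_factor \<le> euler_prod6 k"
  "euler_prod6 k * (1 - 2 / (3 * (6 * real k + 3))) \<le> prodinf euler_factor"
proof -
  have "decseq euler_prod6" using euler_prod6_decreasing by (rule decseq_SucI)
  then show "prodinf euler_factor \<le> euler_prod6 k"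
    using decseq_ge[OF _ euler_prod6_LIMSEQ] by blast
  show "euler_prod6 k * (1 - 2 / (3 * (6 * real k + 3))) \<le> prodinf euler_factor"
  proof (rule LIMSEQ_le)
    show "(\<lambda>m. euler_prod6 (m + k)) \<longlonglongrightarrow> prodinf euler_factor"
      using euler_prod6_LIMSEQ by (rule LIMSEQ_ignore_initial_segment)
    have "euler_prod6 k * (1 - 2 / (3 * (6 * real k + 3))) \<le> euler_prod6 (m + k)" for m
    proof -
      have "1 - 2 / (3 * (6 * real k + 3)) \<le> 1 - 2 / 3 * (1 / (6 * real k + 3) - 1 / (6 * real (k + m) + 3))"
        by (simp add: algebra_simps)
      then have "euler_prod6 k * (1 - 2 / (3 * (6 * real k + 3))) \<le>
          euler_prod6 k * (1 - 2 / 3 * (1 / (6 * real k + 3) - 1 / (6 * real (k + m) + 3)))"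
        using euler_prod6_pos[of k] by (intro mult_left_mono) auto
      also have "\<dots> \<le> euler_prod6 (k + m)" by (rule euler_prod6_tail)
      finally show ?thesis by (simp add: add.commute)
    qed
    then show "\<exists>N. \<forall>m\<ge>N. euler_prod6 k * (1 - 2 / (3 * (6 * real k + 3))) \<le> euler_prod6 (m + k)"
      by blast
  qed simp
qed

section \<open>Numerical evaluation of the Euler product\<close>

definition small_primes_test :: "int \<Rightarrow> bool" where
  "small_primes_test n \<longleftrightarrow> list_all (\<lambda>d. n mod d \<noteq> 0 \<or> n = d) [5, 7, 11, 13, 17, 19, 23, 29, 31, 37, 41, 43, 47]"

lemma prime_less_53:
  fixes q :: nat
  assumes "prime q" "q < 53" "q \<ge> 5"
  shows "int q \<in> set [5, 7, 11, 13, 17, 19, 23, 29, 31, 37, 41, 43, 47]"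
proof -
  have nd: "q = d" if "d dvd q" "d \<noteq> 1" for d using assms(1) that by (auto simp: prime_nat_iff)
  have "\<not> 2 dvd q" "\<not> 3 dvd q" "5 dvd q \<longrightarrow> q = 5" "7 dvd q \<longrightarrow> q = 7"
    using nd[of 2] nd[of 3] nd[of 5] nd[of 7] assms by auto
  moreover have "q \<in> set [5..<53]" unfolding set_upt using assms by simp
  moreover have "list_all (\<lambda>q. 2 dvd q \<or> 3 dvd q \<or> (5 dvd q \<and> q \<noteq> 5) \<or> (7 dvd q \<and> q \<noteq> 7) \<or>
      int q \<in> set [5, 7, 11, 13, 17, 19, 23, 29, 31, 37, 41, 43, 47]) [5..<53]"
    by simp
  ultimately show ?thesis unfolding list_all_iff by blast
qed

text \<open>A composite number below 53^2 has a prime factor below 53; the list contains all of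
  these except 2 and 3, which the hypotheses exclude.\<close>

lemma prime_iff_small_primes_test:
  fixes n :: nat
  assumes n: "n < 53\<^sup>2" and "n > 1" and "\<not> 2 dvd n" "\<not> 3 dvd n"
  shows "prime n \<longleftrightarrow> small_primes_test (int n)"
proof
  assume p: "prime n"
  have "int n mod d \<noteq> 0 \<or> int n = d" if "d \<in> set [5, 7, 11, 13, 17, 19, 23, 29, 31, 37, 41, 43, 47]" for d
  proof -
    have "list_all (\<lambda>d::int. d > 1) [5, 7, 11, 13, 17, 19, 23, 29, 31, 37, 41, 43, 47]" by simp
    then have d: "d > 1" using that unfolding list_all_iff by blast
    have "int n = d" if "d dvd int n"
    proof -
      have "int (nat d) dvd int n" using that d by simp
      then have "nat d dvd n" by (simp only: int_dvd_int_iff)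
      then have "nat d = 1 \<or> nat d = n" using p by (simp add: prime_nat_iff)
      then show ?thesis using d by auto
    qed
    then show ?thesis by (auto simp: dvd_eq_mod_eq_0)
  qed
  then show "small_primes_test (int n)" unfolding small_primes_test_def list_all_iff by (rule ballI)
next
  assume t: "small_primes_test (int n)"
  show "prime n"
  proof (rule ccontr)
    assume np: "\<not> prime n"
    obtain q where q: "prime q" "q dvd n" "q\<^sup>2 \<le> n"
    proof -
      obtain a b where ab: "n = a * b" "a > 1" "b > 1" "a \<le> b"
      proof -
        have "\<exists>a\<in>{2..<n}. a dvd n" using np assms(2) prime_nat_iff'[of n] by blast
        then obtain a where a: "a dvd n" "1 < a" "a < n" by auto
        obtain b where b: "n = a * b" using a(1) unfolding dvd_def by blast
        have "b \<noteq> 0" "b \<noteq> 1" using a b by auto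
        then have b1: "b > 1" by linarith
        show ?thesis
        proof (cases "a \<le> b")
          case True
          then show ?thesis using that[OF b a(2) b1] by simp
        next
          case False
          have "n = b * a" using b by (simp only: mult.commute)
          then show ?thesis using that[OF _ b1 a(2)] False by simp
        qed
      qed
      obtain q where q: "prime q" "q dvd a" using prime_factor_nat[of a] ab(2) by auto
      have "q \<le> a" using q ab by (intro dvd_imp_le) auto
      then have "q * q \<le> a * b" using ab by (intro mult_mono) auto
      then show ?thesis using that[of q] q ab by (simp add: power2_eq_square)
    qed
    have "q\<^sup>2 < 53\<^sup>2" using q n by linarith
    then have q53: "q < 53" using power_less_imp_less_base by blast
    have "q \<noteq> 2" "q \<noteq> 3" "q \<noteq> 4" using q assms(3,4) by auto
    then have q5: "q \<ge> 5" using prime_ge_2_nat[OF q(1)] by linarith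
    have "int n mod int q \<noteq> 0 \<or> int n = int q"
      using t[unfolded small_primes_test_def list_all_iff] prime_less_53[OF q(1) q53 q5] by (rule bspec)
    moreover have "int n mod int q = 0" using q(2) by (simp add: zmod_int[symmetric])
    ultimately have "n = q" by simp
    then show False using np q by simp
  qed
qed

text \<open>Interval arithmetic scaled to integers: multiplies the bounds by the Euler factor at \<open>n\<close>,
  rounding outwards.\<close>

definition factor_step :: "int \<Rightarrow> int \<times> int \<Rightarrow> int \<times> int" where
  "factor_step n = (\<lambda>(l, u). if small_primes_test n
     then (l * (n ^ 3 - 2 * n + 1) div n ^ 3, u * (n ^ 3 - 2 * n + 1) div n ^ 3 + 1) else (l, u))"

definition block_step :: "int \<Rightarrow> int \<times> int \<Rightarrow> int \<times> int" where
  "block_step k lu = factor_step (6 * k + 7) (factor_step (6 * k + 5) lu)"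

definition encloses :: "real \<Rightarrow> int \<times> int \<Rightarrow> bool" where
  "encloses x = (\<lambda>(l, u). real_of_int l \<le> x \<and> x \<le> real_of_int u)"

lemma encloses_factor_step:
  fixes n :: nat
  assumes n: "n < 53\<^sup>2" "n \<ge> 5" "\<not> 2 dvd n" "\<not> 3 dvd n" and x: "encloses x lu"
  shows "encloses (x * euler_factor n) (factor_step (int n) lu)"
proof -
  obtain l u where lu: "lu = (l, u)" by (cases lu) auto
  have lx: "real_of_int l \<le> x" "x \<le> real_of_int u" using x by (auto simp: encloses_def lu)
  have iff: "prime n \<longleftrightarrow> small_primes_test (int n)"
    using n by (intro prime_iff_small_primes_test) auto
  show ?thesis
  proof (cases "prime n")
    case False
    then show ?thesis using lx iff by (simp add: encloses_def lu factor_step_def euler_factor_def)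
  next
    case True
    define N D where "N = int n ^ 3 - 2 * int n + 1" and "D = int n ^ 3"
    have D: "real_of_int D > 0" using n by (simp add: D_def)
    have ef: "euler_factor n = real_of_int N / real_of_int D"
      using True n by (simp add: euler_factor_def N_def D_def field_simps power_numeral_reduce)
    have ef0: "euler_factor n \<ge> 0" using euler_factor_bounds(1)[of n] by simp
    have fl: "real_of_int (m * N div D) \<le> real_of_int m * euler_factor n"
      "real_of_int m * euler_factor n \<le> real_of_int (m * N div D + 1)" for m
    proof -
      have "real_of_int m * euler_factor n = real_of_int (m * N) / real_of_int D" by (simp add: ef)
      then show "real_of_int (m * N div D) \<le> real_of_int m * euler_factor n"
        "real_of_int m * euler_factor n \<le> real_of_int (m * N div D + 1)"
        unfolding floor_divide_of_int_eq[symmetric, where 'a = real] by linarith+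
    qed
    have "real_of_int (l * N div D) \<le> x * euler_factor n"
      using fl(1)[of l] mult_right_mono[OF lx(1) ef0] by linarith
    moreover have "x * euler_factor n \<le> real_of_int (u * N div D + 1)"
      using fl(2)[of u] mult_right_mono[OF lx(2) ef0] by linarith
    ultimately show ?thesis
      using True iff by (simp add: encloses_def lu factor_step_def N_def D_def)
  qed
qed

text \<open>The largest index reached is 6 (k - 1) + 7 = 6 k + 1, at most 2803 for
  \<open>k \<le> 467\<close>. Trial division decides primality below 53^2 = 2809.\<close>

lemma encloses_euler_prod6:
  assumes "k \<le> 467"
  shows "encloses (10 ^ 8 * euler_prod6 k) (fold block_step [0..int k - 1] (10 ^ 8, 10 ^ 8))"
  using assms
proof (induction k)
  case 0
  have "euler_prod6 0 = (\<Prod>i<(3::nat). 1)"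
    unfolding euler_prod6_def by (intro prod.cong) (auto simp: euler_factor_def)
  then show ?case by (simp add: encloses_def)
next
  case (Suc k)
  have "[0..int (Suc k) - 1] = [0..int k - 1] @ [int k]" using upto_rec2[of 0 "int k"] by simp
  then have step: "fold block_step [0..int (Suc k) - 1] (10 ^ 8, 10 ^ 8) =
      factor_step (int (6 * k + 7)) (factor_step (int (6 * k + 5))
        (fold block_step [0..int k - 1] (10 ^ 8, 10 ^ 8)))"
    by (simp add: block_step_def)
  have "\<not> 2 dvd 6 * k + 5" "\<not> 3 dvd 6 * k + 5" "\<not> 2 dvd 6 * k + 7" "\<not> 3 dvd 6 * k + 7"
    by presburger+
  then have "encloses (10 ^ 8 * euler_prod6 k * euler_factor (6 * k + 5) * euler_factor (6 * k + 7))
      (factor_step (int (6 * k + 7)) (factor_step (int (6 * k + 5))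
        (fold block_step [0..int k - 1] (10 ^ 8, 10 ^ 8))))"
    using Suc by (intro encloses_factor_step) auto
  then show ?case unfolding step euler_prod6_Suc by (simp add: mult.assoc)
qed

text \<open>The blocks 0 to 415 give \<open>euler_prod6 416\<close>, the product over indices below
  2499. The relative tail bound is then 2 / (3 * 2499) = 2 / 7497, small enough for four
  decimals.\<close>

lemma fold_block_step_bounds:
  "case fold block_step [0..415] (10 ^ 8, 10 ^ 8) of (l, u) \<Rightarrow> 84099000 \<le> l \<and> u \<le> 84101000"
  by code_simp

lemma prodinf_euler_factor_approx: "\<bar>1 / 3 * prodinf euler_factor - 0.2803\<bar> < 0.00005"
proof -
  obtain l u where lu: "fold block_step [0..415] (10 ^ 8, 10 ^ 8) = (l, u)" by fastforce
  have "84099000 \<le> l" "u \<le> 84101000" using fold_block_step_bounds unfolding lu by auto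
  then have i: "84099000 \<le> real_of_int l" "real_of_int u \<le> 84101000" by linarith+
  have "encloses (10 ^ 8 * euler_prod6 416) (l, u)"
    using encloses_euler_prod6[of 416] unfolding lu[symmetric] by simp
  then have E: "84099000 \<le> 10 ^ 8 * euler_prod6 416" "10 ^ 8 * euler_prod6 416 \<le> 84101000"
    using i unfolding encloses_def prod.case by linarith+
  have "prodinf euler_factor \<le> euler_prod6 416"
    by (rule prodinf_euler_factor_bounds)
  moreover have "euler_prod6 416 * (1 - 2 / 7497) \<le> prodinf euler_factor"
    using prodinf_euler_factor_bounds(2)[of 416] by simp
  moreover have "0.84099 * (1 - 2 / 7497) \<le> euler_prod6 416 * (1 - 2 / 7497)"
    using E by (intro mult_right_mono) auto
  \<comment> \<open>A third of these bounds lies strictly between 0.28025 and 0.28035.\<close>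
  ultimately have "prodinf euler_factor \<le> 0.84101" "0.84076 \<le> prodinf euler_factor"
    using E by simp_all
  then show ?thesis by (simp add: abs_if)
qed

section \<open>The density\<close>

lemma prod_euler_density:
  assumes "z \<ge> 3"
  shows "(\<Prod>p | prime p \<and> p \<le> z. euler_density p) = 1 / 3 * (\<Prod>n\<le>z. euler_factor n)"
proof -
  let ?S = "{p. prime p \<and> p \<le> z}"
  have fin: "finite ?S" by (rule finite_subset[of _ "{..z}"]) auto
  have sub: "{2, 3} \<subseteq> ?S" using assms by auto
  have "prod euler_density ?S = prod euler_density (?S - {2, 3}) * prod euler_density {2, 3}"
    by (rule prod.subset_diff[OF sub fin])
  also have "prod euler_density {2, 3} = 1 / 3" by (simp add: euler_density_def)
  also have "prod euler_density (?S - {2, 3}) = prod euler_factor (?S - {2, 3})"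
  proof (rule prod.cong[OF refl])
    fix p assume p: "p \<in> ?S - {2, 3}"
    then have "p \<noteq> 4" by auto
    then have "p \<ge> 5" using p prime_ge_2_nat[of p] by auto
    then show "euler_density p = euler_factor p" using p by (simp add: euler_density_def euler_factor_def)
  qed
  also have "\<dots> = prod euler_factor {..z}"
    by (rule prod.mono_neutral_left) (auto simp: euler_factor_def)
  finally show ?thesis by simp
qed

lemma height_less_iff:
  assumes "X > 0"
  shows "height a b < X \<longleftrightarrow> \<bar>real_of_int a\<bar> < X ^ 3 \<and> \<bar>real_of_int b\<bar> < X ^ 4"
proof -
  have "root n x < X \<longleftrightarrow> x < X ^ n" if "n > 0" for n and x :: real
  proof -
    have "root n x < root n (X ^ n) \<longleftrightarrow> x < X ^ n" using that by (rule real_root_less_iff)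
    then show ?thesis using that assms by (simp add: real_root_power_cancel)
  qed
  from this[of 3] this[of 4] show ?thesis by (simp add: height_def)
qed

lemma squarefree_qdisc_iff:
  "squarefree (poly_disc (quartic a b)) \<longleftrightarrow>
     qdisc a b \<noteq> 0 \<and> (\<forall>p::nat. prime p \<longrightarrow> \<not> (int p)\<^sup>2 dvd qdisc a b)"
proof (cases "qdisc a b = 0")
  case True
  then show ?thesis by (simp add: poly_disc_quartic qdisc_def)
next
  case False
  have "(\<forall>p::int. prime p \<longrightarrow> \<not> p\<^sup>2 dvd n) \<longleftrightarrow> (\<forall>p::nat. prime p \<longrightarrow> \<not> (int p)\<^sup>2 dvd n)" for n
  proof
    assume *: "\<forall>p::nat. prime p \<longrightarrow> \<not> (int p)\<^sup>2 dvd n"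
    show "\<forall>p::int. prime p \<longrightarrow> \<not> p\<^sup>2 dvd n"
    proof (intro allI impI)
      fix p :: int assume p: "prime p"
      have "prime (nat p)" using p prime_int_nat_transfer[of p] by blast
      moreover have "int (nat p) = p" using prime_gt_0_int[OF p] by simp
      ultimately show "\<not> p\<^sup>2 dvd n" using *[rule_format, of "nat p"] by simp
    qed
  next
    assume *: "\<forall>p::int. prime p \<longrightarrow> \<not> p\<^sup>2 dvd n"
    show "\<forall>p::nat. prime p \<longrightarrow> \<not> (int p)\<^sup>2 dvd n"
    proof (intro allI impI)
      fix p :: nat assume "prime p"
      then have "prime (int p)" by simp
      then show "\<not> (int p)\<^sup>2 dvd n" using * by blast
    qed
  qed
  then show ?thesis
    using squarefree_factorial_semiring[OF False] False
    unfolding poly_disc_quartic qdisc_def by blast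
qed

section \<open>Error terms of the sieve\<close>

definition sieved_pairs :: "nat \<Rightarrow> real \<Rightarrow> (int \<times> int) set" where
  "sieved_pairs z X = {(a, b). \<bar>of_int a\<bar> < X ^ 3 \<and> \<bar>of_int b\<bar> < X ^ 4 \<and>
     (\<forall>p\<in>{p. prime p \<and> p \<le> z}. \<not> (int p)\<^sup>2 dvd qdisc a b)}"

text \<open>These pairs are excluded from the estimates for medium and large primes. The column
  \<open>a = 0\<close> has at most 2 B + 1 of them, and on the zero set of the discriminant
  \<open>a\<close> determines b^3 and hence \<open>b\<close>.\<close>

lemma card_degenerate_pairs_le:
  fixes A B :: real
  assumes A: "A > 0" and B: "B > 0"
  shows "finite {(a, b). \<bar>of_int a\<bar> < A \<and> \<bar>of_int b\<bar> < B \<and> (a = 0 \<or> qdisc a b = 0)}" (is "finite ?T")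
    and "real (card {(a, b). \<bar>of_int a\<bar> < A \<and> \<bar>of_int b\<bar> < B \<and> (a = 0 \<or> qdisc a b = 0)})
      \<le> 2 * A + 2 * B + 2"
proof -
  define I where "I R = {x::int. \<bar>of_int x\<bar> < R}" for R :: real
  have I: "finite (I R)" "real (card (I R)) \<le> 2 * R + 1" if "R > 0" for R
    using card_residue_class[of 1 R 0] that by (auto simp: I_def)
  let ?T1 = "{0::int} \<times> I B" and ?T2 = "{(a, b). a \<in> I A \<and> b \<in> I B \<and> qdisc a b = 0}"
  have T: "?T = ?T1 \<union> ?T2" using A by (auto simp: I_def)
  have f1: "finite ?T1" using I(1)[OF B] by simp
  have f2: "finite ?T2"
    by (rule finite_subset[of _ "I A \<times> I B"]) (use I(1) A B in auto)
  show "finite ?T" unfolding T using f1 f2 by simp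
  have "inj_on fst ?T2"
  proof (rule inj_onI)
    fix x y assume x: "x \<in> ?T2" and y: "y \<in> ?T2" and eq: "fst x = fst y"
    obtain a b c where xy: "x = (a, b)" "y = (a, c)" using eq by (cases x; cases y) auto
    have "256 * b ^ 3 = 256 * c ^ 3" using x y xy by (simp add: qdisc_def)
    then have "real_of_int (b ^ 3) = real_of_int (c ^ 3)" by simp
    then have "root 3 (real_of_int b ^ 3) = root 3 (real_of_int c ^ 3)" by simp
    then have "b = c" by (simp add: odd_real_root_power_cancel)
    then show "x = y" using xy by simp
  qed
  then have "card ?T2 \<le> card (I A)"
    using I(1)[OF A] by (intro card_inj_on_le) auto
  then have "real (card ?T2) \<le> 2 * A + 1" using I(2)[OF A] by linarith
  moreover have "real (card ?T1) \<le> 2 * B + 1" using I(2)[OF B] by (simp add: card_cartesian_product)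
  moreover have "card ?T \<le> card ?T1 + card ?T2" unfolding T by (rule card_Un_le)
  ultimately show "real (card ?T) \<le> 2 * A + 2 * B + 2" by linarith
qed

lemma finite_box:
  fixes A B :: real
  assumes "A > 0" "B > 0"
  shows "finite {(a::int, b::int). \<bar>of_int a\<bar> < A \<and> \<bar>of_int b\<bar> < B \<and> P a b}"
proof (rule finite_subset)
  show "{(a::int, b::int). \<bar>of_int a\<bar> < A \<and> \<bar>of_int b\<bar> < B \<and> P a b} \<subseteq>
    {x::int. \<bar>of_int x\<bar> < A} \<times> {x::int. \<bar>of_int x\<bar> < B}" by auto
  show "finite ({x::int. \<bar>of_int x\<bar> < A} \<times> {x::int. \<bar>of_int x\<bar> < B})"
    using card_residue_class(1)[of 1 A 0] card_residue_class(1)[of 1 B 0] assms by simp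
qed

text \<open>In order: the term 6 A Y from the medium primes, the degenerate pairs, the resolvents
  with an integer root, and the dyadic cells, where \<open>2 * X^2\<close> bounds \<open>w\<close>
  and the logarithm plus 2 bounds \<open>K\<close>. The choice Y = X^(7/2) balances X^3 Y against
  X^10 / Y; both are X^(13/2), up to logarithms, and so negligible against X^7.\<close>

definition sieve_error :: "real \<Rightarrow> real" where
  "sieve_error X = 6 * X ^ 3 * X powr (7 / 2) + 2 * X ^ 3 + 2 * X ^ 4 + 2 + 27 * (2 * X\<^sup>2) ^ 3 +
     (log 2 (136 * X ^ 6) + 2)\<^sup>2 * (2 * 3 ^ 6 * 72 ^ 4 * 4 ^ 8) * (2 * X\<^sup>2) ^ 5 / X powr (7 / 2)"

lemma sqfree_subset_sieved:
  assumes "X > 0"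
  shows "sqfree_disc_pairs_below X \<subseteq> sieved_pairs z X"
  using assms by (auto simp: sqfree_disc_pairs_below_def sieved_pairs_def height_less_iff squarefree_qdisc_iff)

text \<open>A sieved pair without squarefree discriminant is degenerate or has a prime p > z with
  p^2 dividing the discriminant. It belongs to the medium primes if p \<le> Y or p divides
  \<open>a\<close>, and to the large primes otherwise.\<close>

lemma card_sieved_diff_le:
  assumes X: "X \<ge> 16" and z: "z \<ge> 5"
  shows "real (card (sieved_pairs z X)) \<le>
    real (card (sqfree_disc_pairs_below X)) + 18 * X ^ 7 / z + sieve_error X"
proof -
  define Y where "Y = X powr (7 / 2)"
  \<comment> \<open>Lattice reduction uses an integer weight, so X^2 is rounded up.\<close>
  define w where "w = nat \<lceil>X\<^sup>2\<rceil>"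
  \<comment> \<open>17 w^3 is at most 17 * 8 X^6 = 136 X^6, hence below 2^K.\<close>
  define K where "K = nat \<lceil>log 2 (136 * X ^ 6)\<rceil> + 1"
  define M where "M = {(a, b). \<bar>of_int a\<bar> < X ^ 3 \<and> \<bar>of_int b\<bar> < X ^ 4 \<and> a \<noteq> 0 \<and>
    (\<exists>p. prime p \<and> z < p \<and> (real p \<le> Y \<or> int p dvd a) \<and> (int p)\<^sup>2 dvd qdisc a b)}"
  define Z where "Z = {(a, b). \<bar>of_int a\<bar> < X ^ 3 \<and> \<bar>of_int b\<bar> < X ^ 4 \<and> (a = 0 \<or> qdisc a b = 0)}"
  have A: "X ^ 3 > 0" "X ^ 4 > 0" using X by auto
  have AB: "X ^ 3 \<le> X ^ 4" using X by (intro power_increasing) auto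
  have w1: "X\<^sup>2 \<le> real w" unfolding w_def by linarith
  have X2: "X\<^sup>2 \<ge> 1" using X by (simp add: one_le_power)
  have w2: "real w \<le> 2 * X\<^sup>2" unfolding w_def using X2 by linarith
  have w0: "w > 0" using w1 X2 by (cases w) auto
  have YX: "Y \<ge> X ^ 3"
  proof -
    have "X ^ 3 = X powr 3" using X by simp
    also have "\<dots> \<le> Y" unfolding Y_def using X by (intro powr_mono) auto
    finally show ?thesis .
  qed
  \<comment> \<open>This is where \<open>X \<ge> 16\<close> enters: 2 w \<le> 4 X^2 \<le> X^3 \<le>
    Y.\<close>
  have X3: "16 * X\<^sup>2 \<le> X ^ 3" using X by (simp add: power3_eq_cube power2_eq_square mult_right_mono)
  have Y: "Y \<ge> 2 * real w" "Y \<ge> 5" "Y \<ge> 0" using YX X3 w2 X2 by linarith+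
  have w3: "real w ^ 3 \<le> 8 * X ^ 6"
  proof -
    have "real w ^ 3 \<le> (2 * X\<^sup>2) ^ 3" using w2 by (intro power_mono) auto
    also have "\<dots> = 8 * X ^ 6" by (simp add: power_mult_distrib flip: power_mult)
    finally show ?thesis .
  qed
  have L0: "log 2 (136 * X ^ 6) \<ge> 0"
  proof -
    have "1 \<le> X ^ 6" using X by (intro one_le_power) simp
    then have "1 \<le> 136 * X ^ 6" by linarith
    then show ?thesis by (subst zero_le_log_cancel_iff) auto
  qed
  have K: "2 ^ K > 17 * real w ^ 3"
  proof -
    have "17 * real w ^ 3 \<le> 136 * X ^ 6" using w3 by simp
    also have "136 * X ^ 6 = 2 powr log 2 (136 * X ^ 6)" using X by simp
    also have "\<dots> < 2 powr real K"
      by (rule powr_less_mono) (unfold K_def, linarith, simp)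
    also have "\<dots> = 2 ^ K" by (simp add: powr_realpow)
    finally show ?thesis .
  qed
  have K2: "real K \<le> log 2 (136 * X ^ 6) + 2" unfolding K_def using L0 by linarith
  note cM = card_medium_primes_le[OF A(1) AB z Y(3), folded M_def]
  note cL = card_large_prime_pairs_le[OF w0 Y(1,2) K]
  note cZ = card_degenerate_pairs_le[OF A, folded Z_def]
  have sub: "sieved_pairs z X \<subseteq> sqfree_disc_pairs_below X \<union> (M \<union> (large_prime_pairs w Y \<union> Z))"
  proof
    fix x assume "x \<in> sieved_pairs z X"
    then obtain a b where x: "x = (a, b)" and ab: "\<bar>of_int a\<bar> < X ^ 3" "\<bar>of_int b\<bar> < X ^ 4"
      and s: "\<And>p. prime p \<Longrightarrow> p \<le> z \<Longrightarrow> \<not> (int p)\<^sup>2 dvd qdisc a b"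
      by (auto simp: sieved_pairs_def)
    show "x \<in> sqfree_disc_pairs_below X \<union> (M \<union> (large_prime_pairs w Y \<union> Z))"
    proof (cases "a = 0 \<or> qdisc a b = 0 \<or> squarefree (poly_disc (quartic a b))")
      case True
      then show ?thesis using ab X x
        by (auto simp: Z_def sqfree_disc_pairs_below_def height_less_iff)
    next
      case False
      then obtain p where p: "prime p" "(int p)\<^sup>2 dvd qdisc a b"
        by (auto simp: squarefree_qdisc_iff)
      then have pz: "z < p" using s not_le by blast
      show ?thesis
      proof (cases "real p \<le> Y \<or> int p dvd a")
        case True
        then have "x \<in> M" using p pz False ab x by (auto simp: M_def)
        then show ?thesis by blast
      next
        case notM: False
        have "real_of_int (a\<^sup>2) \<le> real w ^ 3"
        proof -
          have "real_of_int (a\<^sup>2) = \<bar>real_of_int a\<bar> ^ 2" by simp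
          also have "\<dots> \<le> (X ^ 3) ^ 2" using ab by (intro power_mono) auto
          also have "\<dots> = (X\<^sup>2) ^ 3" by (simp flip: power_mult)
          also have "\<dots> \<le> real w ^ 3" using w1 by (intro power_mono) auto
          finally show ?thesis .
        qed
        moreover have "real_of_int \<bar>b\<bar> \<le> (real w)\<^sup>2"
        proof -
          have "real_of_int \<bar>b\<bar> \<le> (X\<^sup>2)\<^sup>2" using ab by (simp flip: power_mult)
          also have "\<dots> \<le> (real w)\<^sup>2" using w1 by (intro power_mono) auto
          finally show ?thesis .
        qed
        ultimately have "x \<in> large_prime_pairs w Y"
          unfolding large_prime_pairs_def x using False notM p by (auto simp: not_le)
        then show ?thesis by blast
      qed
    qed
  qed
  have finS: "finite (sqfree_disc_pairs_below X)"
    using finite_box[OF A, of "\<lambda>a b. squarefree (poly_disc (quartic a b))"] X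
    by (simp add: sqfree_disc_pairs_below_def height_less_iff conj_assoc)
  have "card (sieved_pairs z X) \<le> card (sqfree_disc_pairs_below X \<union> (M \<union> (large_prime_pairs w Y \<union> Z)))"
    by (rule card_mono[OF _ sub]) (use finS cM(1) cL(1) cZ(1) in blast)
  also have "\<dots> \<le> card (sqfree_disc_pairs_below X) + (card M + (card (large_prime_pairs w Y) + card Z))"
    by (intro order_trans[OF card_Un_le] add_left_mono card_Un_le)
  finally have 1: "real (card (sieved_pairs z X)) \<le> real (card (sqfree_disc_pairs_below X)) +
      (real (card M) + (real (card (large_prime_pairs w Y)) + real (card Z)))"
    by (simp flip: of_nat_add)
  have "(real K)\<^sup>2 * (2 * 3 ^ 6 * 72 ^ 4 * 4 ^ 8) * real w ^ 5 / Y \<le>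
     (log 2 (136 * X ^ 6) + 2)\<^sup>2 * (2 * 3 ^ 6 * 72 ^ 4 * 4 ^ 8) * (2 * X\<^sup>2) ^ 5 / Y"
    using K2 w2 Y by (intro divide_right_mono mult_mono power_mono mult_right_mono) auto
  moreover have "27 * real w ^ 3 \<le> 27 * (2 * X\<^sup>2) ^ 3"
    using w2 by (intro mult_left_mono power_mono) auto
  moreover have "18 * X ^ 3 * X ^ 4 / z = 18 * X ^ 7 / z"
    by (simp add: power_add[symmetric] mult.assoc)
  ultimately show ?thesis
    using 1 cM(2) cL(2) cZ(2) unfolding sieve_error_def Y_def[symmetric] by linarith
qed

lemma sieve_error_tendsto: "((\<lambda>X. sieve_error X / (4 * X ^ 7)) \<longlongrightarrow> 0) at_top"
  unfolding sieve_error_def by real_asymp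

theorem theorem1p2:
  shows "convergent_prod euler_factor
    \<and> ((\<lambda>X::real. real (card (sqfree_disc_pairs_below X)) / real (card (pairs_below X)))
         \<longlongrightarrow> 1 / 3 * (\<Prod>p. euler_factor p)) at_top
    \<and> \<bar>1 / 3 * (\<Prod>p. euler_factor p) - 0.2803\<bar> < 0.00005"
proof (intro conjI)
  show "convergent_prod euler_factor" by (rule convergent_prod_euler_factor)
  show "\<bar>1 / 3 * (\<Prod>p. euler_factor p) - 0.2803\<bar> < 0.00005" by (rule prodinf_euler_factor_approx)
  define c where "c = 1 / 3 * prodinf euler_factor"
  define V where "V X = (2 * X ^ 3) * (2 * X ^ 4)" for X :: real
  define f where "f X = real (card (sqfree_disc_pairs_below X)) / V X" for X
  define g where "g z X = real (card (sieved_pairs z X)) / V X" for z X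
  have V: "V X = 4 * X ^ 7" for X by (simp add: V_def power_add[symmetric])
  have AB: "filterlim (\<lambda>X::real. X ^ 3) at_top at_top" "filterlim (\<lambda>X::real. X ^ 4) at_top at_top"
    by real_asymp+
  define cz where "cz z = 1 / 3 * (\<Prod>n\<le>z. euler_factor n)" for z
  have g: "(g z \<longlongrightarrow> cz z) at_top" if "z \<ge> 3" for z
  proof -
    have "finite {p. prime p \<and> p \<le> z}" by (rule finite_subset[of _ "{..z}"]) auto
    from sieved_density[OF this _ AB] show ?thesis
      unfolding g_def[abs_def] sieved_pairs_def V_def cz_def prod_euler_density[OF that] by simp
  qed
  have cz: "cz \<longlonglongrightarrow> c"
    unfolding cz_def c_def
    by (intro tendsto_mult tendsto_const convergent_prod_LIMSEQ convergent_prod_euler_factor)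
  have "(f \<longlongrightarrow> c) at_top"
  proof (rule tendstoI)
    fix e :: real assume e: "e > 0"
    have lim: "(\<lambda>z. 9 / (2 * real z)) \<longlonglongrightarrow> 0" by real_asymp
    \<comment> \<open>First \<open>z\<close> is fixed, making the Euler tail and 18 X^7 / z relative
      to the area 4 X^7, that is 9 / (2 z), each less than a quarter of \<open>e\<close>. Large
      \<open>X\<close> then takes care of the other two quarters.\<close>
    have "\<forall>\<^sub>F z in sequentially. dist (cz z) c < e / 4 \<and> dist (9 / (2 * real z)) 0 < e / 4 \<and> z \<ge> 5"
      using e by (intro eventually_conj tendstoD[OF cz] tendstoD[OF lim] eventually_ge_at_top) auto
    from eventually_happens'[OF sequentially_bot this]
    obtain z where z: "dist (cz z) c < e / 4" "dist (9 / (2 * real z)) 0 < e / 4" "z \<ge> 5"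
      by blast
    have "\<forall>\<^sub>F X in at_top. dist (g z X) (cz z) < e / 4"
      by (rule tendstoD[OF g]) (use z e in auto)
    moreover have "\<forall>\<^sub>F X in at_top. dist (sieve_error X / (4 * X ^ 7)) 0 < e / 4"
      by (rule tendstoD[OF sieve_error_tendsto]) (use e in auto)
    moreover have "\<forall>\<^sub>F X::real in at_top. X \<ge> 16" by (rule eventually_ge_at_top)
    ultimately show "\<forall>\<^sub>F X in at_top. dist (f X) c < e"
    proof eventually_elim
      case (elim X)
      have X: "X > 0" "V X > 0" using elim by (auto simp: V)
      have "finite (sieved_pairs z X)"
        unfolding sieved_pairs_def using X by (intro finite_box) auto
      then have "card (sqfree_disc_pairs_below X) \<le> card (sieved_pairs z X)"
        using sqfree_subset_sieved[OF X(1)] card_mono by blast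
      then have up: "f X \<le> g z X" unfolding f_def g_def using X by (intro divide_right_mono) auto
      have "g z X \<le> (real (card (sqfree_disc_pairs_below X)) + 18 * X ^ 7 / z + sieve_error X) / V X"
        unfolding g_def using card_sieved_diff_le[OF elim(3) z(3)] X by (intro divide_right_mono) auto
      also have "\<dots> = f X + 9 / (2 * real z) + sieve_error X / (4 * X ^ 7)"
        using X z(3) unfolding f_def V by (simp add: field_simps)
      finally show ?case using up elim z unfolding dist_real_def by linarith
    qed
  qed
  \<comment> \<open>The full box is the sieve over the empty set of primes, of density 1.\<close>
  moreover have "((\<lambda>X. real (card (pairs_below X)) / V X) \<longlongrightarrow> 1) at_top"
  proof -
    have "\<forall>\<^sub>F X in at_top. real (card {(a::int, b::int). \<bar>of_int a\<bar> < X ^ 3 \<and> \<bar>of_int b\<bar> < X ^ 4 \<and>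
        (\<forall>p\<in>{}. \<not> (int p)\<^sup>2 dvd qdisc a b)}) / V X = real (card (pairs_below X)) / V X"
      using eventually_gt_at_top[of 0]
      by eventually_elim (simp add: pairs_below_def height_less_iff)
    from Lim_transform_eventually[OF _ this] show ?thesis
      using sieved_density[of "{}", OF _ _ AB] by (simp add: V_def)
  qed
  ultimately have lim: "((\<lambda>X. f X / (real (card (pairs_below X)) / V X)) \<longlongrightarrow> c / 1) at_top"
    by (intro tendsto_divide) auto
  have ev: "\<forall>\<^sub>F X in at_top. f X / (real (card (pairs_below X)) / V X) =
      real (card (sqfree_disc_pairs_below X)) / real (card (pairs_below X))"
    using eventually_gt_at_top[of 0] by eventually_elim (simp add: f_def V)
  from Lim_transform_eventually[OF lim ev]
  show "((\<lambda>X::real. real (card (sqfree_disc_pairs_below X)) / real (card (pairs_below X)))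
         \<longlongrightarrow> 1 / 3 * (\<Prod>p. euler_factor p)) at_top"
    by (simp add: c_def)
qed

end
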